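(* Let $p\ge1$, $n\ge3p$, $\mathcal{F}>0$, and let $Q:\mathbb{R}^n\rightrightarrows\mathbb{R}^n$, $Q(u)=\prod_{i=1}^p\tilde Q(u^i)\times Q^R(u^R)$, be the mapping defined in the context. Then $Q$ is an SCD mapping, $$\mathcal{O}_Q=\left\{\big((u^1,\ldots,u^p,u^R),(w^1,\ldots,w^p,0)\big): (u^i,w^i)\in\mathcal{O}_{\tilde Q},\ i=1,\dots,p,\ u^R\in\mathbb{R}^{n-3p}\right\},$$ and for every $(u,w)=\big((u^1,\ldots,u^p,u^R),(w^1,\ldots,w^p,0)\big)\in\mathrm{gph}\,Q$ we have $$\mathcal{S}Q(u,w)=\Big\{\mathrm{rge}\big[\mathrm{diag}(U^1,\ldots,U^p,I_{n-3p}),\ \mathrm{diag}(W^1,\ldots,W^p,0)\big]\ :\ \mathrm{rge}(U^i,W^i)\in\mathcal{S}\tilde Q(u^i,w^i),\ i=1,\ldots,p\Big\},$$ $$\mathcal{S}^*Q(u,w)=\Big\{\mathrm{rge}\big[\mathrm{diag}({W^*}^1,\ldots,{W^*}^p,I_{n-3p}),\ \mathrm{diag}({U^*}^1,\ldots,{U^*}^p,0)\big]\ :\ \mathrm{rge}({W^*}^i,{U^*}^i)\in\mathcal{S}^*\tilde Q(u^i,w^i),\ i=1,\ldots,p\Big\},$$ where $\mathrm{diag}$ denotes block-diagonal matrices with $3\times3$ blocks in the first $p$ positions and a block of size $(n-3p)\times(n-3p)$ in the last position.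
   Context: Vectors $u\in\mathbb{R}^n$ are partitioned as $u=(u^1,\dots,u^p,u^R)$ with $u^i\in\mathbb{R}^3$, $u^R\in\mathbb{R}^{n-3p}$. For $v\in\mathbb{R}^3$ write $v_{12}=(v_1,v_2)$. The mapping $\tilde Q:\mathbb{R}^3\rightrightarrows\mathbb{R}^3$ is given by $$\tilde Q(v)=\{(g,\vartheta)\in\mathbb{R}^2\times\mathbb{R}: \vartheta\in N_{\mathbb{R}_+}(v_3),\ g\in-\mathcal{F}\vartheta\,\partial\|v_{12}\|\},$$ where $\partial\|\cdot\|$ is the convex subdifferential of the Euclidean norm on $\mathbb{R}^2$ and $N_{\mathbb{R}_+}$ is the normal cone mapping of $[0,\infty)$ (empty at negative arguments). $Q^R:\mathbb{R}^{n-3p}\rightrightarrows\mathbb{R}^{n-3p}$ is $Q^R(v)=\{0\}$. SCD notions, for $F:\mathbb{R}^m\rightrightarrows\mathbb{R}^m$ with graph $\mathrm{gph}\,F=\{(x,y):y\in F(x)\}$. For a set $A$ and $\bar a\in A$, the tangent (contingent) cone $T_A(\bar a)$ is the set of all $u$ for which there are $t_k\downarrow0$, $u_k\to u$ with $\bar a+t_ku_k\in A$. $\mathcal{Z}_m$ is the metric space of $m$-dimensional subspaces of $\mathbb{R}^{2m}$ with $d_{\mathcal{Z}_m}(L_1,L_2)=\|P_{L_1}-P_{L_2}\|$ ($P_L$ the orthogonal projection onto $L$). For $L\in\mathcal{Z}_m$, $L^*:=\{(-v^*,u^* ):(u^*,v^* )\in L^\perp\}$. For $m\times m$ matrices $A,B$,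 $\mathrm{rge}(A,B)=\mathrm{rge}[A,B]=\{(Au,Bu):u\in\mathbb{R}^m\}$. $\mathcal{O}_F$ is the set of $(x,y)\in\mathrm{gph}\,F$ with $T_{\mathrm{gph}\,F}(x,y)\in\mathcal{Z}_m$. $\mathcal{S}F(x,y)$ (resp. $\mathcal{S}^*F(x,y)$) is the set of all limits in $\mathcal{Z}_m$ of sequences $T_{\mathrm{gph}\,F}(x_k,y_k)$ (resp. $T_{\mathrm{gph}\,F}(x_k,y_k)^*$) with $(x_k,y_k)\in\mathcal{O}_F$, $(x_k,y_k)\to(x,y)$. $F$ is an SCD mapping if $\mathcal{S}^*F(x,y)\neq\emptyset$ for every $(x,y)\in\mathrm{gph}\,F$. *)

theory Defs
  imports "HOL-Analysis.Analysis"
begin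

section \<open>SCD mappings\<close>

text \<open>A set-valued mapping is a function into sets (empty outside its domain).\<close>

definition gph :: "('a \<Rightarrow> 'b set) \<Rightarrow> ('a \<times> 'b) set" where
  "gph F = {(x, y). y \<in> F x}"

definition tangent_cone :: "'a::real_normed_vector set \<Rightarrow> 'a \<Rightarrow> 'a set" where
  "tangent_cone A a = {u. \<exists>t v. (\<forall>k::nat. (0::real) < t k) \<and> t \<longlonglongrightarrow> 0 \<and> v \<longlonglongrightarrow> u
     \<and> (\<forall>k. a + t k *\<^sub>R v k \<in> A)}"

text \<open>The space \<open>\<Z>\<^sub>m\<close>: the \<open>2m\<close>-dimensional Euclidean space is
  \<open>(real^'m) \<times> (real^'m)\<close>, whose norm and inner product are the Euclidean ones.\<close>

definition Zspace :: "((real^'m) \<times> (real^'m)) set set" where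
  "Zspace = {L. subspace L \<and> dim L = CARD('m)}"

definition orth_proj :: "'a::euclidean_space set \<Rightarrow> 'a \<Rightarrow> 'a" where
  "orth_proj L x = (THE y. y \<in> L \<and> x - y \<in> orthogonal_comp L)"

definition dist_Z :: "((real^'m) \<times> (real^'m)) set \<Rightarrow> ((real^'m) \<times> (real^'m)) set \<Rightarrow> real" where
  "dist_Z L1 L2 = onorm (\<lambda>x. orth_proj L1 x - orth_proj L2 x)"

definition adj :: "((real^'m) \<times> (real^'m)) set \<Rightarrow> ((real^'m) \<times> (real^'m)) set" where
  "adj L = {(- v, u) | u v. (u, v) \<in> orthogonal_comp L}"

definition rge :: "real^'m^'m \<Rightarrow> real^'m^'m \<Rightarrow> ((real^'m) \<times> (real^'m)) set" where
  "rge A B = range (\<lambda>u. (A *v u, B *v u))"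

definition scd_O :: "(real^'m \<Rightarrow> (real^'m) set) \<Rightarrow> ((real^'m) \<times> (real^'m)) set" where
  "scd_O F = {z \<in> gph F. tangent_cone (gph F) z \<in> Zspace}"

definition scd_S :: "(real^'m \<Rightarrow> (real^'m) set) \<Rightarrow> (real^'m) \<times> (real^'m) \<Rightarrow> ((real^'m) \<times> (real^'m)) set set" where
  "scd_S F z = {L \<in> Zspace. \<exists>zs. (\<forall>k::nat. zs k \<in> scd_O F) \<and> zs \<longlonglongrightarrow> z
     \<and> (\<lambda>k. dist_Z (tangent_cone (gph F) (zs k)) L) \<longlonglongrightarrow> 0}"

definition scd_S_adj :: "(real^'m \<Rightarrow> (real^'m) set) \<Rightarrow> (real^'m) \<times> (real^'m) \<Rightarrow> ((real^'m) \<times> (real^'m)) set set" where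
  "scd_S_adj F z = {L \<in> Zspace. \<exists>zs. (\<forall>k::nat. zs k \<in> scd_O F) \<and> zs \<longlonglongrightarrow> z
     \<and> (\<lambda>k. dist_Z (adj (tangent_cone (gph F) (zs k))) L) \<longlonglongrightarrow> 0}"

definition SCD :: "(real^'m \<Rightarrow> (real^'m) set) \<Rightarrow> bool" where
  "SCD F \<longleftrightarrow> (\<forall>z \<in> gph F. scd_S_adj F z \<noteq> {})"

section \<open>The mapping of the friction problem\<close>

definition normal_cone :: "'a::real_inner set \<Rightarrow> 'a \<Rightarrow> 'a set" where
  "normal_cone C x = (if x \<in> C then {s. \<forall>y\<in>C. inner s (y - x) \<le> 0} else {})"

definition subdifferential :: "('a::real_inner \<Rightarrow> real) \<Rightarrow> 'a \<Rightarrow> 'a set" where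
  "subdifferential f x = {s. \<forall>y. f x + inner s (y - x) \<le> f y}"

definition fst2 :: "real^3 \<Rightarrow> real^2" where
  "fst2 v = vector [v $ 1, v $ 2]"

text \<open>\<open>w\<close> is the pair \<open>(g, \<theta>)\<close> read as a vector of three components.\<close>

definition Qt :: "real \<Rightarrow> real^3 \<Rightarrow> (real^3) set" where
  "Qt \<F> v = {w. w $ 3 \<in> normal_cone {0..} (v $ 3)
     \<and> fst2 w \<in> (\<lambda>s. - (\<F> * w $ 3) *\<^sub>R s) ` subdifferential norm (fst2 v)}"

text \<open>Below, \<open>e\<close> enumerates the \<open>n = CARD('n)\<close> coordinates of \<open>real^'n\<close> by \<open>0, \<dots>, n - 1\<close>, so
  block \<open>i < p\<close> (counted from 0) consists of the coordinates \<open>3 i\<close>, \<open>3 i + 1\<close>, \<open>3 i + 2\<close>.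
  As \<open>n - 3 p\<close> may be 0, a vector of length \<open>n - 3 p\<close> is a function on the natural numbers that
  vanishes from \<open>n - 3 p\<close> on.\<close>

definition block :: "(nat \<Rightarrow> 'n) \<Rightarrow> nat \<Rightarrow> real^'n \<Rightarrow> real^3" where
  "block e i u = vector [u $ e (3 * i), u $ e (3 * i + 1), u $ e (3 * i + 2)]"

definition rest :: "(nat \<Rightarrow> 'n) \<Rightarrow> nat \<Rightarrow> real^'n \<Rightarrow> nat \<Rightarrow> real" where
  "rest e p u = (\<lambda>k. if k < CARD('n) - 3 * p then u $ e (3 * p + k) else 0)"

definition QR :: "(nat \<Rightarrow> real) \<Rightarrow> (nat \<Rightarrow> real) set" where
  "QR v = {\<lambda>k. 0}"

definition QQ :: "(nat \<Rightarrow> 'n) \<Rightarrow> nat \<Rightarrow> real \<Rightarrow> real^'n \<Rightarrow> (real^'n) set" where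
  "QQ e p \<F> u = {w. (\<forall>i<p. block e i w \<in> Qt \<F> (block e i u)) \<and> rest e p w \<in> QR (rest e p u)}"

text \<open>\<open>coord3 a\<close> is the index, within its block, of coordinate \<open>a\<close>; note \<open>(3::3) = 0\<close>.
  In \<open>blockdiag e p A C\<close>, the last block has the entries \<open>C k l\<close> for \<open>k, l < n - 3 p\<close>.\<close>

definition coord3 :: "nat \<Rightarrow> 3" where
  "coord3 a = (if a mod 3 = 0 then 1 else if a mod 3 = 1 then 2 else 3)"

definition blockdiag ::
    "(nat \<Rightarrow> 'n::finite) \<Rightarrow> nat \<Rightarrow> (nat \<Rightarrow> real^3^3) \<Rightarrow> (nat \<Rightarrow> nat \<Rightarrow> real) \<Rightarrow> real^'n^'n" where
  "blockdiag e p A C = (\<chi> r c.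
     let a = inv_into {..<CARD('n)} e r; b = inv_into {..<CARD('n)} e c in
     if a < 3 * p \<and> b < 3 * p then
       (if a div 3 = b div 3 then A (a div 3) $ coord3 a $ coord3 b else 0)
     else if 3 * p \<le> a \<and> 3 * p \<le> b then C (a - 3 * p) (b - 3 * p)
     else 0)"

definition Id_entries :: "nat \<Rightarrow> nat \<Rightarrow> real" where
  "Id_entries k l = (if k = l then 1 else 0)"

definition Zero_entries :: "nat \<Rightarrow> nat \<Rightarrow> real" where
  "Zero_entries k l = 0"

end

theory Submission
  imports Defs
begin

text \<open>Up to the free component \<open>u\<^sup>R\<close>, the graph of \<open>Q\<close> is the product of \<open>p\<close> copies of the
  graph of \<open>Qt\<close>. The tangent cone of a product is in general smaller than the product of the tangent
  cones, but the two agree if the former is a subspace (it contains each factor), or if all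
  factors are derivable. A point of the graph of \<open>Qt\<close> with a subspace as tangent cone lies on one of
  three smooth three-dimensional pieces (no contact, slip, stick), so it is derivable with a
  tangent space of dimension 3; this yields \<open>\<O>\<^sub>Q\<close>. For limits, the projection onto a product splits
  into the projections onto the factors, so a limit of products is the product of the limits. The
  adjoint derivative follows because \<open>adj\<close> is a continuous involution that respects products.\<close>


subsection \<open>Convergence of subspaces and adjoint subspaces\<close>

text \<open>The distance on \<open>Zspace\<close> is an operator norm; in finite dimension it tends
  to 0 exactly when the projections converge pointwise, and in that form both products and
  \<open>adj\<close> are handled by explicit formulas. The main obstacle is dimension: a product
  subspace of dimension \<open>n\<close> fixes only the sum of the dimensions of its factors, not
  that each of them is 3. For tangent cones the gap closes because every tangent cone to the graph
  of \<open>Qt\<close> that is a subspace has dimension 3; for limits it closes because the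
  dimension is locally constant for \<open>dist_Z\<close>. Nonemptiness of the derivatives at a
  nonsmooth point comes from approaching it inside a smooth piece along which the tangent space
  stays the same. The product is formed inside a subspace \<open>C\<close> rather than with an extra
  factor for the last component, so no type of dimension \<open>n - 3p\<close>, possibly 0, has to
  be introduced.\<close>

lemma orth_proj_eqI:
  assumes "subspace L" "y \<in> L" "\<And>l. l \<in> L \<Longrightarrow> inner (x - y) l = 0"
  shows "orth_proj L x = y"
  unfolding orth_proj_def
proof (rule the_equality)
  show "y \<in> L \<and> x - y \<in> orthogonal_comp L"
    using assms by (auto simp: orthogonal_comp_def orthogonal_def inner_commute)
next
  fix z assume z: "z \<in> L \<and> x - z \<in> orthogonal_comp L"
  have yz: "y - z \<in> L" using z assms(1,2) by (simp add: subspace_diff)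
  have "inner (x - z) (y - z) = 0"
    using z yz by (auto simp: orthogonal_comp_def orthogonal_def inner_commute)
  moreover have "inner (x - y) (y - z) = 0" using assms(3) yz by blast
  ultimately have "inner (y - z) (y - z) = 0"
    by (simp add: inner_diff_left)
  then show "z = y" by simp
qed

lemma orth_proj:
  assumes "subspace L"
  shows orth_proj_in: "orth_proj L x \<in> L"
    and orth_proj_orthogonal: "\<And>l. l \<in> L \<Longrightarrow> inner (x - orth_proj L x) l = 0"
proof -
  have "x \<in> L + orthogonal_comp L"
    using subspace_sum_orthogonal_comp[OF assms] by auto
  then obtain y z where yz: "x = y + z" "y \<in> L" "z \<in> orthogonal_comp L"
    by (auto elim: set_plus_elim)
  have o: "inner (x - y) l = 0" if "l \<in> L" for l
    using yz that by (auto simp: orthogonal_comp_def orthogonal_def inner_commute)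
  have "orth_proj L x = y" using orth_proj_eqI[OF assms yz(2) o] by blast
  then show "orth_proj L x \<in> L" "\<And>l. l \<in> L \<Longrightarrow> inner (x - orth_proj L x) l = 0"
    using yz o by auto
qed

lemma orth_proj_id: "subspace L \<Longrightarrow> x \<in> L \<Longrightarrow> orth_proj L x = x"
  by (rule orth_proj_eqI) auto

lemma linear_orth_proj:
  assumes "subspace L"
  shows "linear (orth_proj L)"
proof (rule linearI)
  show "orth_proj L (x + y) = orth_proj L x + orth_proj L y" for x y
  proof (rule orth_proj_eqI[OF assms])
    show "orth_proj L x + orth_proj L y \<in> L"
      using orth_proj_in[OF assms] assms by (simp add: subspace_add)
    fix l assume l: "l \<in> L"
    show "inner (x + y - (orth_proj L x + orth_proj L y)) l = 0"
      using orth_proj_orthogonal[OF assms l, of x] orth_proj_orthogonal[OF assms l, of y]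
      by (simp add: inner_diff_left inner_add_left)
  qed
  show "orth_proj L (c *\<^sub>R x) = c *\<^sub>R orth_proj L x" for c x
  proof (rule orth_proj_eqI[OF assms])
    show "c *\<^sub>R orth_proj L x \<in> L"
      using orth_proj_in[OF assms] assms by (simp add: subspace_scale)
    fix l assume l: "l \<in> L"
    show "inner (c *\<^sub>R x - c *\<^sub>R orth_proj L x) l = 0"
      using orth_proj_orthogonal[OF assms l, of x]
      by (simp add: inner_diff_left)
  qed
qed

lemma bounded_linear_orth_proj_diff:
  assumes "subspace L" "subspace M"
  shows "bounded_linear (\<lambda>x. orth_proj L x - orth_proj M x)"
  using assms by (intro bounded_linear_sub) (simp_all add: linear_orth_proj linear_conv_bounded_linear[symmetric])

text \<open>Expand \<open>x\<close> in the orthonormal basis and bound each coordinate by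
  \<open>norm x\<close>. This controls the operator norm by finitely many vectors, which is how
  pointwise convergence becomes convergence in \<open>dist_Z\<close>.\<close>

lemma dist_Z_le_sum:
  assumes "subspace L" "subspace M"
  shows "dist_Z L M \<le> (\<Sum>b\<in>Basis. norm (orth_proj L b - orth_proj M b))"
  unfolding dist_Z_def
proof (rule onorm_le)
  fix x :: "(real^'a) \<times> (real^'a)"
  define f where "f = (\<lambda>x. orth_proj L x - orth_proj M x)"
  interpret bounded_linear f
    unfolding f_def by (rule bounded_linear_orth_proj_diff[OF assms])
  have "f x = f (\<Sum>b\<in>Basis. inner x b *\<^sub>R b)" by (simp only: euclidean_representation)
  also have "\<dots> = (\<Sum>b\<in>Basis. inner x b *\<^sub>R f b)" by (simp only: sum scaleR)
  also have "norm \<dots> \<le> (\<Sum>b\<in>Basis. norm x * norm (f b))"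
    by (rule sum_norm_le) (auto intro!: mult_right_mono Basis_le_norm)
  finally show "norm (orth_proj L x - orth_proj M x)
      \<le> (\<Sum>b\<in>Basis. norm (orth_proj L b - orth_proj M b)) * norm x"
    by (simp add: f_def sum_distrib_left mult.commute)
qed

lemma norm_orth_proj_diff_le:
  assumes "subspace L" "subspace M"
  shows "norm (orth_proj L x - orth_proj M x) \<le> dist_Z L M * norm x"
  unfolding dist_Z_def using onorm[OF bounded_linear_orth_proj_diff[OF assms]] .

lemma dist_Z_nonneg:
  assumes "subspace L" "subspace M"
  shows "0 \<le> dist_Z L M"
  unfolding dist_Z_def using onorm_pos_le[OF bounded_linear_orth_proj_diff[OF assms]] .

lemma dist_Z_tendsto_0_iff:
  assumes "\<And>k. subspace (L k)" "subspace M"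
  shows "(\<lambda>k. dist_Z (L k) M) \<longlonglongrightarrow> 0 \<longleftrightarrow> (\<forall>x. (\<lambda>k. orth_proj (L k) x) \<longlonglongrightarrow> orth_proj M x)"
proof (intro iffI allI)
  fix x assume d: "(\<lambda>k. dist_Z (L k) M) \<longlonglongrightarrow> 0"
  show "(\<lambda>k. orth_proj (L k) x) \<longlonglongrightarrow> orth_proj M x"
    unfolding LIM_zero_iff[symmetric, of "\<lambda>k. orth_proj (L k) x"]
  proof (rule Lim_null_comparison)
    show "\<forall>\<^sub>F k in sequentially. norm (orth_proj (L k) x - orth_proj M x) \<le> dist_Z (L k) M * norm x"
      using norm_orth_proj_diff_le[OF assms] by auto
    show "(\<lambda>k. dist_Z (L k) M * norm x) \<longlonglongrightarrow> 0"
      using tendsto_mult_left_zero[OF d] .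
  qed
next
  assume p: "\<forall>x. (\<lambda>k. orth_proj (L k) x) \<longlonglongrightarrow> orth_proj M x"
  show "(\<lambda>k. dist_Z (L k) M) \<longlonglongrightarrow> 0"
  proof (rule Lim_null_comparison)
    show "\<forall>\<^sub>F k in sequentially.
        norm (dist_Z (L k) M) \<le> (\<Sum>b\<in>Basis. norm (orth_proj (L k) b - orth_proj M b))"
      using dist_Z_le_sum[OF assms] dist_Z_nonneg[OF assms] by auto
    show "(\<lambda>k. \<Sum>b\<in>Basis. norm (orth_proj (L k) b - orth_proj M b)) \<longlonglongrightarrow> 0"
      by (intro tendsto_null_sum tendsto_norm_zero LIM_zero) (use p in auto)
  qed
qed

text \<open>If \<open>x\<close> in \<open>M\<close> is annihilated by the projection onto
  \<open>L\<close>, then \<open>norm x\<close> is the norm of the difference of the two projections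
  at \<open>x\<close>, at most \<open>dist_Z L M * norm x\<close>; hence \<open>x = 0\<close>, and
  the projection embeds \<open>M\<close> into \<open>L\<close>.\<close>

lemma dim_le_of_dist_Z_less_1:
  assumes "subspace L" "subspace M" "dist_Z L M < 1"
  shows "dim M \<le> dim L"
proof -
  have "inj_on (orth_proj L) M"
  proof -
    have "x = 0" if x: "x \<in> M" "orth_proj L x = 0" for x
    proof (rule ccontr)
      assume "x \<noteq> 0"
      have "norm x \<le> dist_Z L M * norm x"
        using norm_orth_proj_diff_le[OF assms(1,2), of x] x orth_proj_id[OF assms(2), of x] by simp
      then show False using \<open>x \<noteq> 0\<close> assms(3) by simp
    qed
    then show ?thesis
      using linear_inj_on_iff_eq_0[OF linear_orth_proj[OF assms(1)] assms(2)] by blast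
  qed
  then have "dim (orth_proj L ` M) = dim M"
    using dim_image_eq[OF linear_orth_proj[OF assms(1)]] assms(2) by (simp add: span_eq_iff[THEN iffD2])
  moreover have "orth_proj L ` M \<subseteq> L" using orth_proj_in[OF assms(1)] by auto
  ultimately show ?thesis using dim_subset by metis
qed

lemma dist_Z_commute: "dist_Z L M = dist_Z M L"
proof -
  have "onorm (\<lambda>x. - (orth_proj M x - orth_proj L x)) = onorm (\<lambda>x. orth_proj M x - orth_proj L x)"
    by (rule onorm_neg)
  then show ?thesis by (simp add: dist_Z_def)
qed

text \<open>Used for the blocks of a limit subspace, which are known to be subspaces but whose
  dimension is only visible through the approximating tangent spaces.\<close>

lemma Zspace_limit:
  assumes "\<And>k. L k \<in> Zspace" "subspace M" "(\<lambda>k. dist_Z (L k) M) \<longlonglongrightarrow> 0"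
  shows "M \<in> Zspace"
proof -
  have "\<forall>\<^sub>F k in sequentially. dist_Z (L k) M < 1"
    using order_tendstoD(2)[OF assms(3), of 1] by simp
  then obtain k where k: "dist_Z (L k) M < 1" by (auto simp: eventually_sequentially)
  have "dim (L k) = CARD('a)" "subspace (L k)" using assms(1) by (auto simp: Zspace_def)
  then show ?thesis
    using dim_le_of_dist_Z_less_1[of "L k" M] dim_le_of_dist_Z_less_1[of M "L k"] k assms(2)
    by (simp add: Zspace_def dist_Z_commute)
qed

text \<open>The condition is orthogonality of \<open>(b, - a)\<close> to \<open>L\<close>, so
  \<open>adj L\<close> is the complement of \<open>L\<close> for the symplectic form that sends
  \<open>(u, v)\<close>, \<open>(a, b)\<close> to \<open>inner b u - inner a v\<close>. This
  explains why \<open>adj\<close> is an involution on subspaces.\<close>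

lemma mem_adj_iff: "(a, b) \<in> adj L \<longleftrightarrow> (\<forall>u v. (u, v) \<in> L \<longrightarrow> inner b u = inner a v)"
proof -
  have "(a, b) \<in> adj L \<longleftrightarrow> (b, - a) \<in> orthogonal_comp L"
    by (force simp: adj_def)
  also have "\<dots> \<longleftrightarrow> (\<forall>u v. (u, v) \<in> L \<longrightarrow> inner b u = inner a v)"
    by (auto simp: orthogonal_comp_def orthogonal_def inner_commute)
  finally show ?thesis .
qed

lemma subspace_adj: "subspace (adj L)"
  unfolding subspace_def
  by (auto simp: mem_adj_iff zero_prod_def inner_add_left)

text \<open>With the isometry \<open>J (u, v) = (- v, u)\<close>, \<open>adj L\<close> is the image
  under \<open>J\<close> of the orthogonal complement of \<open>L\<close>, so its projection is
  \<open>J\<close> after \<open>I - orth_proj L\<close> after the inverse of \<open>J\<close>. It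
  depends continuously on the projection onto \<open>L\<close>, whence the continuity of
  \<open>adj\<close>.\<close>

lemma orth_proj_adj:
  assumes "subspace L"
  shows "orth_proj (adj L) (a, b)
    = (a, b) + (snd (orth_proj L (b, - a)), - fst (orth_proj L (b, - a)))"
proof -
  obtain c d where cd: "orth_proj L (b, - a) = (c, d)" by fastforce
  have L: "(c, d) \<in> L" using orth_proj_in[OF assms, of "(b, - a)"] cd by simp
  have o: "inner (b - c) u + inner (- a - d) v = 0" if "(u, v) \<in> L" for u v
    using orth_proj_orthogonal[OF assms that, of "(b, - a)"] cd by (simp add: inner_prod_def)
  show ?thesis
    unfolding cd
  proof (rule orth_proj_eqI[OF subspace_adj])
    show "(a, b) + (snd (c, d), - fst (c, d)) \<in> adj L"
      unfolding plus_prod_def fst_conv snd_conv mem_adj_iff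
      using o by (auto simp: inner_diff_left inner_add_left) (smt (verit))
  next
    fix l assume "l \<in> adj L"
    then show "inner ((a, b) - ((a, b) + (snd (c, d), - fst (c, d)))) l = 0"
      using L by (cases l) (auto simp: mem_adj_iff inner_prod_def inner_commute)
  qed
qed

lemma adj_adj:
  assumes "subspace L"
  shows "adj (adj L) = L"
proof -
  have "(a, b) \<in> adj (adj L) \<longleftrightarrow> (a, b) \<in> L" for a b
  proof
    assume ab: "(a, b) \<in> adj (adj L)"
    obtain c d where cd: "orth_proj L (a, b) = (c, d)" by fastforce
    have L: "(c, d) \<in> L" using orth_proj_in[OF assms, of "(a, b)"] cd by simp
    have o: "inner (a - c) u + inner (b - d) v = 0" if "(u, v) \<in> L" for u v
      using orth_proj_orthogonal[OF assms that, of "(a, b)"] cd by (simp add: inner_prod_def)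
    \<comment> \<open>This is the residual of the projection, rotated by the isometry that defines
      \<open>adj\<close>. Pairing it with \<open>(a, b)\<close> shows that the residual is
      orthogonal to \<open>(a, b)\<close>; being orthogonal to \<open>(c, d)\<close> as well, it is
      orthogonal to itself.\<close>
    have "(- (b - d), a - c) \<in> adj L"
      unfolding mem_adj_iff using o by (auto simp: inner_diff_left inner_add_left) (smt (verit))
    then have "inner b (- (b - d)) = inner a (a - c)"
      using ab by (auto simp: mem_adj_iff)
    moreover have "inner (a - c) c + inner (b - d) d = 0" using o[OF L] .
    ultimately have "inner (a - c) (a - c) + inner (b - d) (b - d) = 0"
      by (simp add: inner_diff_left inner_diff_right inner_commute)
    then have "a = c" "b = d"
      by (metis add_nonneg_eq_0_iff inner_eq_zero_iff inner_ge_zero right_minus_eq)+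
    then show "(a, b) \<in> L" using L by simp
  next
    assume "(a, b) \<in> L"
    then show "(a, b) \<in> adj (adj L)"
      by (auto simp: mem_adj_iff[of a b "adj L"]) (auto simp: mem_adj_iff inner_commute)
  qed
  then show ?thesis by auto
qed

lemma adj_limit:
  assumes "\<And>k. subspace (L k)" "subspace M" "(\<lambda>k. dist_Z (L k) M) \<longlonglongrightarrow> 0"
  shows "(\<lambda>k. dist_Z (adj (L k)) (adj M)) \<longlonglongrightarrow> 0"
proof -
  have p: "(\<lambda>k. orth_proj (L k) x) \<longlonglongrightarrow> orth_proj M x" for x
    using assms(3) dist_Z_tendsto_0_iff[where L = L and M = M] assms(1,2) by blast
  have "(\<lambda>k. orth_proj (adj (L k)) x) \<longlonglongrightarrow> orth_proj (adj M) x" for x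
    by (cases x) (auto simp: orth_proj_adj assms intro!: tendsto_intros p)
  then show ?thesis using dist_Z_tendsto_0_iff[where L = "\<lambda>k. adj (L k)" and M = "adj M"] subspace_adj by blast
qed

lemma adj_Zspace:
  assumes "L \<in> Zspace"
  shows "adj L \<in> Zspace"
proof -
  have L: "subspace L" "dim L = CARD('a)" using assms by (auto simp: Zspace_def)
  let ?J = "\<lambda>z. (- snd z, fst z) :: (real^'a) \<times> (real^'a)"
  have J: "linear ?J" by (rule linearI) (auto simp: prod_eq_iff)
  have "adj L = ?J ` orthogonal_comp L" by (force simp: adj_def image_def)
  then have "dim (adj L) = dim (orthogonal_comp L)"
    using dim_image_eq[OF J] by (simp add: inj_on_def prod_eq_iff)
  moreover have "dim (orthogonal_comp L) + dim L = 2 * CARD('a)"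
    using dim_subspace_orthogonal_to_vectors[OF L(1) subspace_UNIV]
    by (simp add: orthogonal_comp_def)
  ultimately show ?thesis using L subspace_adj by (simp add: Zspace_def)
qed

text \<open>Valid for every mapping, since \<open>adj\<close> is continuous and preserves
  \<open>Zspace\<close>. The involution property enters when a limit of adjoint tangent spaces is
  turned back into a limit of tangent spaces.\<close>

lemma scd_S_adj_eq: "scd_S_adj F z = adj ` scd_S F z"
proof -
  have T: "tangent_cone (gph F) z \<in> Zspace" if "z \<in> scd_O F" for z
    using that by (simp add: scd_O_def)
  have Z: "subspace L" if "L \<in> Zspace" for L :: "((real^'a) \<times> (real^'a)) set"
    using that by (simp add: Zspace_def)
  show ?thesis
  proof (intro equalityI subsetI)
    fix L assume "L \<in> scd_S_adj F z"
    then obtain zs where L: "L \<in> Zspace" and zs: "\<And>k::nat. zs k \<in> scd_O F" "zs \<longlonglongrightarrow> z"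
      and lim: "(\<lambda>k. dist_Z (adj (tangent_cone (gph F) (zs k))) L) \<longlonglongrightarrow> 0"
      by (auto simp: scd_S_adj_def)
    have "(\<lambda>k. dist_Z (adj (adj (tangent_cone (gph F) (zs k)))) (adj L)) \<longlonglongrightarrow> 0"
      by (rule adj_limit[OF subspace_adj Z[OF L] lim])
    then have "adj L \<in> scd_S F z"
      using adj_Zspace[OF L] zs adj_adj[OF Z[OF T]] by (auto simp: scd_S_def)
    then show "L \<in> adj ` scd_S F z" using adj_adj[OF Z[OF L]] by force
  next
    fix M assume "M \<in> adj ` scd_S F z"
    then obtain L zs where M: "M = adj L" and L: "L \<in> Zspace"
      and zs: "\<And>k::nat. zs k \<in> scd_O F" "zs \<longlonglongrightarrow> z"
      and lim: "(\<lambda>k. dist_Z (tangent_cone (gph F) (zs k)) L) \<longlonglongrightarrow> 0"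
      by (auto simp: scd_S_def)
    have "(\<lambda>k. dist_Z (adj (tangent_cone (gph F) (zs k))) (adj L)) \<longlonglongrightarrow> 0"
      by (rule adj_limit[OF Z[OF T[OF zs(1)]] Z[OF L] lim])
    then show "M \<in> scd_S_adj F z"
      using adj_Zspace[OF L] zs by (auto simp: scd_S_adj_def M)
  qed
qed

section \<open>Subspaces of half the dimension as ranges of matrix pairs\<close>

lemma linear_rge_map:
  fixes A B :: "real^'m^'m"
  shows "linear (\<lambda>u. (A *v u, B *v u))"
  unfolding linear_conv_bounded_linear
  by (intro bounded_linear_Pair) (simp_all flip: linear_conv_bounded_linear)

text \<open>Equal dimension gives a linear bijection from \<open>real^'m\<close> onto
  \<open>L\<close>; the matrices of its two components are \<open>A\<close> and \<open>B\<close>.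
  Injectivity is recorded because an injective pair conversely certifies membership in
  \<open>Zspace\<close>.\<close>

lemma Zspace_rgeE:
  assumes "L \<in> Zspace"
  obtains A B where "L = rge A B" "inj (\<lambda>u. (A *v u, B *v u))"
proof -
  have "\<exists>f. linear f \<and> f ` (UNIV :: (real^'a) set) = L \<and> inj_on f UNIV"
    using assms by (intro subspace_isomorphism) (auto simp: Zspace_def)
  then obtain f :: "real^'a \<Rightarrow> _" where f: "linear f" "range f = L" "inj f" by blast
  have l: "linear (fst \<circ> f)" "linear (snd \<circ> f)"
    using f(1) by (auto intro!: linear_compose[of f] simp: linear_fst linear_snd)
  have eq: "f = (\<lambda>u. (matrix (fst \<circ> f) *v u, matrix (snd \<circ> f) *v u))"
    using matrix_vector_mul(2)[OF l(1)] matrix_vector_mul(2)[OF l(2)] by (metis comp_apply prod.collapse)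
  show ?thesis
    using that[of "matrix (fst \<circ> f)" "matrix (snd \<circ> f)"] f eq unfolding rge_def by metis
qed

lemma Zspace_family_rge:
  fixes p :: nat
  assumes "\<And>i. i < p \<Longrightarrow> L i \<in> Zspace"
  shows "\<exists>A B. \<forall>i<p. L i = rge (A i) (B i) \<and> inj (\<lambda>u. (A i *v u, B i *v u))"
proof -
  have "\<forall>i\<in>{..<p}. \<exists>M. L i = rge (fst M) (snd M) \<and> inj (\<lambda>u. (fst M *v u, snd M *v u))"
  proof
    fix i assume "i \<in> {..<p}"
    then have "L i \<in> Zspace" using assms by simp
    from Zspace_rgeE[OF this] obtain A B where "L i = rge A B" "inj (\<lambda>u. (A *v u, B *v u))" .
    then show "\<exists>M. L i = rge (fst M) (snd M) \<and> inj (\<lambda>u. (fst M *v u, snd M *v u))"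
      by (intro exI[of _ "(A, B)"]) simp
  qed
  from bchoice[OF this] obtain M where
    "\<forall>i\<in>{..<p}. L i = rge (fst (M i)) (snd (M i)) \<and> inj (\<lambda>u. (fst (M i) *v u, snd (M i) *v u))" ..
  then show ?thesis by (intro exI[of _ "\<lambda>i. fst (M i)"] exI[of _ "\<lambda>i. snd (M i)"]) simp
qed

lemma rge_Zspace:
  fixes A B :: "real^'m^'m"
  assumes "inj (\<lambda>u. (A *v u, B *v u))"
  shows "rge A B \<in> Zspace"
proof -
  have "dim (range (\<lambda>u. (A *v u, B *v u))) = dim (UNIV :: (real^'m) set)"
    by (rule dim_image_eq[OF linear_rge_map]) (use assms in simp)
  moreover have "subspace (range (\<lambda>u. (A *v u, B *v u)))"
    by (rule linear_subspace_image[OF linear_rge_map subspace_UNIV])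
  ultimately show ?thesis by (simp add: rge_def Zspace_def)
qed


subsection \<open>Tangent cones and charts\<close>

lemma null_sequence: "(\<lambda>k. 1 / (1 + real k)) \<longlonglongrightarrow> 0"
  using LIMSEQ_inverse_real_of_nat by (simp add: inverse_eq_divide)

lemma tangent_coneI:
  "(\<And>k::nat. 0 < t k) \<Longrightarrow> t \<longlonglongrightarrow> 0 \<Longrightarrow> v \<longlonglongrightarrow> u \<Longrightarrow> (\<And>k. a + t k *\<^sub>R v k \<in> A)
    \<Longrightarrow> u \<in> tangent_cone A a"
  unfolding tangent_cone_def by blast

lemma tangent_coneE:
  assumes "u \<in> tangent_cone A a"
  obtains t v where "\<And>k::nat. 0 < t k" "t \<longlonglongrightarrow> 0" "v \<longlonglongrightarrow> u" "\<And>k. a + t k *\<^sub>R v k \<in> A"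
  using assms unfolding tangent_cone_def by blast

text \<open>Geometric derivability: every tangent direction is attained along \<^emph>\<open>every\<close> null sequence of
  step sizes. This is what makes the tangent cone of a product the product of the tangent cones.\<close>

definition derivable_at :: "'a::real_normed_vector set \<Rightarrow> 'a \<Rightarrow> bool" where
  "derivable_at A a \<longleftrightarrow> (\<forall>u\<in>tangent_cone A a. \<forall>t. (\<forall>k::nat. 0 < t k) \<and> t \<longlonglongrightarrow> 0 \<longrightarrow>
     (\<exists>v. v \<longlonglongrightarrow> u \<and> (\<forall>k. a + t k *\<^sub>R v k \<in> A)))"

text \<open>The direction \<open>h k\<close> may vary with \<open>k\<close>, as it does when a
  tangent sequence is read in a chart. The Frechet derivative controls this uniformly in the
  direction.\<close>

lemma has_derivative_quotient_LIMSEQ: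
  fixes f :: "'a::real_normed_vector \<Rightarrow> 'b::real_normed_vector"
  assumes f: "(f has_derivative f') (at p)"
    and t: "\<And>k::nat. 0 < t k" "t \<longlonglongrightarrow> 0" and h: "h \<longlonglongrightarrow> h0"
  shows "(\<lambda>k. (f (p + t k *\<^sub>R h k) - f p) /\<^sub>R t k) \<longlonglongrightarrow> f' h0"
proof -
  interpret f': bounded_linear f' using f by (rule has_derivative_bounded_linear)
  define r where "r = (\<lambda>y. norm (f (p + y) - f p - f' y) / norm y)"
  have r0: "(r \<longlongrightarrow> 0) (at 0)"
    using f unfolding has_derivative_at r_def by simp
  \<comment> \<open>Division by zero makes the relative remainder vanish at 0, so it is continuous
    there and the indices with \<open>h k = 0\<close> need no separate limit argument.\<close>
  have "r 0 = 0" by (simp add: r_def)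
  then have rn: "(r \<longlongrightarrow> 0) (nhds 0)"
    using r0 tendsto_at_iff_tendsto_nhds[of r 0] by simp
  have "(\<lambda>k. t k *\<^sub>R h k) \<longlonglongrightarrow> 0"
    using tendsto_scaleR[OF t(2) h] by simp
  then have rl: "(\<lambda>k. r (t k *\<^sub>R h k)) \<longlonglongrightarrow> 0"
    using rn filterlim_compose by blast
  have e: "(f (p + t k *\<^sub>R h k) - f p) /\<^sub>R t k - f' (h k)
      = (f (p + t k *\<^sub>R h k) - f p - f' (t k *\<^sub>R h k)) /\<^sub>R t k" for k
    using t(1)[of k] by (simp add: f'.scaleR scaleR_diff_right)
  have n: "norm ((f (p + t k *\<^sub>R h k) - f p) /\<^sub>R t k - f' (h k)) = r (t k *\<^sub>R h k) * norm (h k)" for k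
    unfolding e using t(1)[of k] by (cases "h k = 0") (simp_all add: r_def divide_simps f'.zero)
  have "(\<lambda>k. (f (p + t k *\<^sub>R h k) - f p) /\<^sub>R t k - f' (h k)) \<longlonglongrightarrow> 0"
    by (rule tendsto_norm_zero_cancel)
      (use tendsto_mult[OF rl tendsto_norm[OF h]] in \<open>simp add: n\<close>)
  from tendsto_add[OF this f'.tendsto[OF h]] show ?thesis by simp
qed

text \<open>Near \<open>a\<close> the set is a graph over the parameter space: \<open>\<phi>\<close>
  parametrizes it and the linear map \<open>\<pi>\<close> reads off the parameters. The derivative
  of \<open>\<phi>\<close> at the single point \<open>\<pi> a\<close> then determines the tangent
  cone, since a tangent vector \<open>u\<close> must equal \<open>\<phi>' (\<pi> u)\<close>.\<close>

lemma tangent_cone_chart: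
  fixes \<phi> :: "'a::euclidean_space \<Rightarrow> 'b::euclidean_space" and \<pi> :: "'b \<Rightarrow> 'a"
  assumes \<phi>: "(\<phi> has_derivative \<phi>') (at (\<pi> a))" and \<pi>: "linear \<pi>" "\<And>q. \<pi> (\<phi> q) = q"
    and a: "a \<in> A" and chart: "\<forall>\<^sub>F z in nhds a. z \<in> A \<longleftrightarrow> z = \<phi> (\<pi> z)"
  shows "tangent_cone A a = range \<phi>'" "derivable_at A a" "subspace (tangent_cone A a)"
    "dim (tangent_cone A a) = DIM('a)"
proof -
  interpret \<phi>': bounded_linear \<phi>' using \<phi> by (rule has_derivative_bounded_linear)
  interpret \<pi>: bounded_linear \<pi> using \<pi>(1) by (simp add: linear_conv_bounded_linear)
  have a': "\<phi> (\<pi> a) = a" using a chart eventually_nhds_x_imp_x by force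
  \<comment> \<open>Applied to one fixed null sequence this gives tangency of
    \<open>\<phi>' h\<close>; applied to all of them it gives derivability.\<close>
  have path: "\<exists>v. v \<longlonglongrightarrow> \<phi>' h \<and> (\<forall>k. a + t k *\<^sub>R v k \<in> A)"
    if t: "\<And>k::nat. 0 < t k" "t \<longlonglongrightarrow> 0" for t h
  proof -
    define w where "w = (\<lambda>k. (\<phi> (\<pi> a + t k *\<^sub>R h) - a) /\<^sub>R t k)"
    \<comment> \<open>The chart is only local, whereas membership in \<open>A\<close> is demanded
      for every \<open>k\<close>. The default direction 0 stays at \<open>a\<close>, and it occurs
      only finitely often.\<close>
    define v where "v = (\<lambda>k. if a + t k *\<^sub>R w k \<in> A then w k else 0)"
    have w: "a + t k *\<^sub>R w k = \<phi> (\<pi> a + t k *\<^sub>R h)" for k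
      using t(1)[of k] by (simp add: w_def)
    have wl: "w \<longlonglongrightarrow> \<phi>' h"
      using has_derivative_quotient_LIMSEQ[OF \<phi> t tendsto_const[of h]] by (simp add: w_def a')
    have "(\<lambda>k. a + t k *\<^sub>R w k) \<longlonglongrightarrow> a + 0 *\<^sub>R \<phi>' h"
      by (intro tendsto_intros t wl)
    then have "\<forall>\<^sub>F k in sequentially. (a + t k *\<^sub>R w k \<in> A) = (a + t k *\<^sub>R w k = \<phi> (\<pi> (a + t k *\<^sub>R w k)))"
      using chart by (simp add: filterlim_iff) blast
    then have "\<forall>\<^sub>F k in sequentially. v k = w k"
      by eventually_elim (simp add: v_def w \<pi>(2))
    then have "v \<longlonglongrightarrow> \<phi>' h" using wl tendsto_cong by fast
    moreover have "a + t k *\<^sub>R v k \<in> A" for k using a by (simp add: v_def)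
    ultimately show ?thesis by blast
  qed
  have null: "\<And>k. (0::real) < 1 / (1 + real k)" "(\<lambda>k. 1 / (1 + real k)) \<longlonglongrightarrow> 0"
    using null_sequence by simp_all
  have sup: "\<phi>' h \<in> tangent_cone A a" for h
    using path[OF null, of h] tangent_coneI[OF null] by blast
  have sub: "u = \<phi>' (\<pi> u)" if "u \<in> tangent_cone A a" for u
    using that
  proof (rule tangent_coneE)
    fix t v assume t: "\<And>k::nat. 0 < t k" "t \<longlonglongrightarrow> 0" and v: "v \<longlonglongrightarrow> u"
      and A: "\<And>k. a + t k *\<^sub>R v k \<in> A"
    have "(\<lambda>k. a + t k *\<^sub>R v k) \<longlonglongrightarrow> a + 0 *\<^sub>R u"
      by (intro tendsto_intros t v)
    then have "\<forall>\<^sub>F k in sequentially. (a + t k *\<^sub>R v k \<in> A) = (a + t k *\<^sub>R v k = \<phi> (\<pi> (a + t k *\<^sub>R v k)))"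
      using chart by (simp add: filterlim_iff) blast
    then have "\<forall>\<^sub>F k in sequentially. a + t k *\<^sub>R v k = \<phi> (\<pi> (a + t k *\<^sub>R v k))"
      using A by simp
    then have "\<forall>\<^sub>F k in sequentially. (\<phi> (\<pi> a + t k *\<^sub>R \<pi> (v k)) - \<phi> (\<pi> a)) /\<^sub>R t k = v k"
    proof eventually_elim
      case (elim k)
      have "\<phi> (\<pi> a + t k *\<^sub>R \<pi> (v k)) - \<phi> (\<pi> a) = t k *\<^sub>R v k"
        using elim by (simp add: \<pi>.add \<pi>.scaleR a' algebra_simps)
      then show ?case using t(1)[of k] by simp
    qed
    moreover have "(\<lambda>k. (\<phi> (\<pi> a + t k *\<^sub>R \<pi> (v k)) - \<phi> (\<pi> a)) /\<^sub>R t k) \<longlonglongrightarrow> \<phi>' (\<pi> u)"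
      by (rule has_derivative_quotient_LIMSEQ[OF \<phi> t \<pi>.tendsto[OF v]])
    ultimately have "v \<longlonglongrightarrow> \<phi>' (\<pi> u)" using tendsto_cong by fast
    then show ?thesis using v LIMSEQ_unique by blast
  qed
  show T: "tangent_cone A a = range \<phi>'" using sup sub by auto
  show "derivable_at A a" unfolding derivable_at_def T using path by auto
  have l: "linear \<phi>'" by (rule \<phi>'.linear)
  show "subspace (tangent_cone A a)"
    unfolding T by (rule linear_subspace_image[OF l subspace_UNIV])
  \<comment> \<open>Differentiating the identity \<open>\<pi> (\<phi> q) = q\<close> yields a left
    inverse of \<open>\<phi>'\<close>, hence full rank.\<close>
  have "((\<lambda>q. \<pi> (\<phi> q)) has_derivative (\<lambda>h. \<pi> (\<phi>' h))) (at (\<pi> a))"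
    by (rule bounded_linear.has_derivative[OF \<pi>.bounded_linear_axioms \<phi>])
  then have "((\<lambda>q. q) has_derivative (\<lambda>h. \<pi> (\<phi>' h))) (at (\<pi> a))"
    by (simp add: \<pi>(2))
  then have "(\<lambda>h. \<pi> (\<phi>' h)) = (\<lambda>h. h)"
    using has_derivative_unique has_derivative_ident by blast
  then have "inj \<phi>'" by (metis injI)
  then show "dim (tangent_cone A a) = DIM('a)"
    unfolding T using dim_image_eq[OF l, of UNIV] by simp
qed


subsection \<open>Products along orthogonal blocks\<close>

text \<open>The maps \<open>\<epsilon> i\<close> embed pairwise orthogonal copies of \<open>'y\<close> into \<open>'z\<close>, and \<open>\<beta> i\<close> is the adjoint of
  \<open>\<epsilon> i\<close>. The subspace \<open>C\<close> contains these copies, so \<open>PR A\<close> is the product of the sets \<open>A i\<close> and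
  of the part of \<open>C\<close> orthogonal to all the copies.\<close>

locale orthogonal_blocks =
  fixes p :: nat and \<beta> :: "nat \<Rightarrow> 'z::euclidean_space \<Rightarrow> 'y::euclidean_space"
    and \<epsilon> :: "nat \<Rightarrow> 'y \<Rightarrow> 'z" and C :: "'z set"
  assumes linear_\<beta>: "i < p \<Longrightarrow> linear (\<beta> i)"
    and linear_\<epsilon>: "i < p \<Longrightarrow> linear (\<epsilon> i)"
    and \<beta>\<epsilon>: "i < p \<Longrightarrow> j < p \<Longrightarrow> \<beta> i (\<epsilon> j y) = (if i = j then y else 0)"
    and adjoint_\<beta>\<epsilon>: "i < p \<Longrightarrow> inner (\<beta> i z) y = inner z (\<epsilon> i y)"
    and C: "subspace C" "i < p \<Longrightarrow> \<epsilon> i y \<in> C"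
begin

definition PR :: "(nat \<Rightarrow> 'y set) \<Rightarrow> 'z set" where
  "PR A = {z \<in> C. \<forall>i<p. \<beta> i z \<in> A i}"

definition sum_\<epsilon> :: "(nat \<Rightarrow> 'y) \<Rightarrow> 'z" where
  "sum_\<epsilon> y = (\<Sum>i<p. \<epsilon> i (y i))"

lemma sum_\<epsilon>_in_C: "sum_\<epsilon> y \<in> C"
  unfolding sum_\<epsilon>_def by (intro subspace_sum C) auto

lemma \<beta>_sum_\<epsilon>: "j < p \<Longrightarrow> \<beta> j (sum_\<epsilon> y) = y j"
  unfolding sum_\<epsilon>_def by (simp add: linear_sum[OF linear_\<beta>] \<beta>\<epsilon>)

lemma \<beta>_add: "i < p \<Longrightarrow> \<beta> i (x + y) = \<beta> i x + \<beta> i y"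
  by (rule linear_add[OF linear_\<beta>])

lemma \<beta>_diff: "i < p \<Longrightarrow> \<beta> i (x - y) = \<beta> i x - \<beta> i y"
  by (rule linear_diff[OF linear_\<beta>])

lemma \<beta>_scaleR: "i < p \<Longrightarrow> \<beta> i (c *\<^sub>R x) = c *\<^sub>R \<beta> i x"
  by (rule linear_scale[OF linear_\<beta>])

lemma \<beta>_tendsto: "i < p \<Longrightarrow> (f \<longlongrightarrow> l) F \<Longrightarrow> ((\<lambda>k. \<beta> i (f k)) \<longlongrightarrow> \<beta> i l) F"
  using bounded_linear.tendsto linear_\<beta> linear_conv_bounded_linear by blast

lemma sum_\<epsilon>_tendsto:
  "(\<And>i. i < p \<Longrightarrow> ((\<lambda>k. f k i) \<longlongrightarrow> l i) F) \<Longrightarrow> ((\<lambda>k. sum_\<epsilon> (f k)) \<longlongrightarrow> sum_\<epsilon> l) F"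
  unfolding sum_\<epsilon>_def
  by (intro tendsto_sum) (use bounded_linear.tendsto linear_\<epsilon> linear_conv_bounded_linear in blast)

lemma sum_\<epsilon>_0: "sum_\<epsilon> (\<lambda>i. 0) = 0"
  unfolding sum_\<epsilon>_def by (simp add: linear_0[OF linear_\<epsilon>])

lemma subspace_PR:
  assumes "\<And>i. i < p \<Longrightarrow> subspace (L i)"
  shows "subspace (PR L)"
  using C(1) assms unfolding PR_def subspace_def
  by (auto simp: \<beta>_add \<beta>_scaleR linear_0[OF linear_\<beta>])

lemma tangent_cone_PR_subset:
  assumes "a \<in> C"
  shows "tangent_cone (PR A) a \<subseteq> PR (\<lambda>i. tangent_cone (A i) (\<beta> i a))"
proof
  fix u assume "u \<in> tangent_cone (PR A) a"
  then show "u \<in> PR (\<lambda>i. tangent_cone (A i) (\<beta> i a))"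
  proof (rule tangent_coneE)
    fix t v assume t: "\<And>k::nat. 0 < t k" "t \<longlonglongrightarrow> 0" and v: "v \<longlonglongrightarrow> u"
      and A: "\<And>k. a + t k *\<^sub>R v k \<in> PR A"
    have "v k \<in> C" for k
    proof -
      have "(a + t k *\<^sub>R v k) - a \<in> C"
        using A[of k] assms by (intro subspace_diff C) (auto simp: PR_def)
      then show ?thesis
        using subspace_scale[OF C(1), of "t k *\<^sub>R v k" "inverse (t k)"] t(1)[of k] by simp
    qed
    then have "u \<in> C"
      using closed_sequentially[OF closed_subspace[OF C(1)] _ v] by blast
    moreover have "\<beta> i u \<in> tangent_cone (A i) (\<beta> i a)" if "i < p" for i
      using t \<beta>_tendsto[OF that v]
    proof (rule tangent_coneI)
      show "\<beta> i a + t k *\<^sub>R \<beta> i (v k) \<in> A i" for k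
        using A[of k] that by (auto simp: PR_def \<beta>_add \<beta>_scaleR)
    qed
    ultimately show ?thesis by (simp add: PR_def)
  qed
qed

lemma tangent_cone_PR_derivable:
  assumes a: "a \<in> C" and der: "\<And>i. i < p \<Longrightarrow> derivable_at (A i) (\<beta> i a)"
  shows "tangent_cone (PR A) a = PR (\<lambda>i. tangent_cone (A i) (\<beta> i a))"
proof
  show "PR (\<lambda>i. tangent_cone (A i) (\<beta> i a)) \<subseteq> tangent_cone (PR A) a"
  proof
    fix u assume "u \<in> PR (\<lambda>i. tangent_cone (A i) (\<beta> i a))"
    then have u: "u \<in> C" "\<And>i. i < p \<Longrightarrow> \<beta> i u \<in> tangent_cone (A i) (\<beta> i a)"
      by (auto simp: PR_def)
    define t where "t = (\<lambda>k. 1 / (1 + real k))"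
    have t: "\<And>k. 0 < t k" "t \<longlonglongrightarrow> 0"
      using null_sequence by (simp_all add: t_def)
    have "\<forall>i. \<exists>v. i < p \<longrightarrow> v \<longlonglongrightarrow> \<beta> i u \<and> (\<forall>k. \<beta> i a + t k *\<^sub>R v k \<in> A i)"
      using der u(2) t unfolding derivable_at_def by meson
    then obtain v where v: "\<And>i. i < p \<Longrightarrow> v i \<longlonglongrightarrow> \<beta> i u"
      "\<And>i k. i < p \<Longrightarrow> \<beta> i a + t k *\<^sub>R v i k \<in> A i" by metis
    \<comment> \<open>The correction replaces block \<open>i\<close> of \<open>u\<close> by
      \<open>v i k\<close> and leaves the component outside the blocks unchanged. Derivability
      allows the same step sizes \<open>t\<close> in all blocks.\<close>
    have "(\<lambda>k. u + sum_\<epsilon> (\<lambda>i. v i k - \<beta> i u)) \<longlonglongrightarrow> u + sum_\<epsilon> (\<lambda>i. \<beta> i u - \<beta> i u)"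
      by (intro tendsto_intros sum_\<epsilon>_tendsto v)
    then have "(\<lambda>k. u + sum_\<epsilon> (\<lambda>i. v i k - \<beta> i u)) \<longlonglongrightarrow> u"
      by (simp add: sum_\<epsilon>_0)
    then show "u \<in> tangent_cone (PR A) a"
    proof (rule tangent_coneI[OF t])
      show "a + t k *\<^sub>R (u + sum_\<epsilon> (\<lambda>i. v i k - \<beta> i u)) \<in> PR A" for k
        using v(2) by (auto simp: PR_def \<beta>_add \<beta>_scaleR \<beta>_sum_\<epsilon>
            intro!: subspace_add subspace_scale C a u sum_\<epsilon>_in_C)
    qed
  qed
qed (rule tangent_cone_PR_subset[OF a])

lemma tangent_cone_PR_subspace:
  assumes a: "a \<in> PR A" and T: "subspace (tangent_cone (PR A) a)"
  shows "tangent_cone (PR A) a = PR (\<lambda>i. tangent_cone (A i) (\<beta> i a))"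
    and "i < p \<Longrightarrow> subspace (tangent_cone (A i) (\<beta> i a))"
proof -
  have aC: "a \<in> C" using a by (simp add: PR_def)
  \<comment> \<open>Moving in block \<open>i\<close> alone keeps the other blocks at those of
    \<open>a\<close>, so no common step size for several blocks is involved; combining blocks is
    left to the closure of the subspace under sums.\<close>
  have emb: "\<epsilon> i y \<in> tangent_cone (PR A) a"
    if i: "i < p" and y: "y \<in> tangent_cone (A i) (\<beta> i a)" for i y
    using y
  proof (rule tangent_coneE)
    fix t v assume t: "\<And>k::nat. 0 < t k" "t \<longlonglongrightarrow> 0" and v: "v \<longlonglongrightarrow> y"
      and A: "\<And>k. \<beta> i a + t k *\<^sub>R v k \<in> A i"
    have "(\<lambda>k. \<epsilon> i (v k)) \<longlonglongrightarrow> \<epsilon> i y"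
      using bounded_linear.tendsto linear_\<epsilon>[OF i] linear_conv_bounded_linear v by blast
    then show ?thesis
    proof (rule tangent_coneI[OF t])
      show "a + t k *\<^sub>R \<epsilon> i (v k) \<in> PR A" for k
        using A[of k] a i by (auto simp: PR_def \<beta>_add \<beta>_scaleR \<beta>\<epsilon>
            intro!: subspace_add subspace_scale C)
    qed
  qed
  \<comment> \<open>Along such directions the product is unrestricted, so the whole ray from
    \<open>a\<close> stays in it.\<close>
  have ker: "r \<in> tangent_cone (PR A) a" if r: "r \<in> C" "\<And>i. i < p \<Longrightarrow> \<beta> i r = 0" for r
  proof (rule tangent_coneI)
    show "(\<lambda>k. 1 / (1 + real k)) \<longlonglongrightarrow> 0" by (rule null_sequence)
    show "(\<lambda>k. r) \<longlonglongrightarrow> r" by simp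
    show "a + (1 / (1 + real k)) *\<^sub>R r \<in> PR A" for k
      using a r by (auto simp: PR_def \<beta>_add \<beta>_scaleR intro!: subspace_add subspace_scale C)
  qed simp
  show eq: "tangent_cone (PR A) a = PR (\<lambda>i. tangent_cone (A i) (\<beta> i a))"
  proof
    show "PR (\<lambda>i. tangent_cone (A i) (\<beta> i a)) \<subseteq> tangent_cone (PR A) a"
    proof
      fix u assume u: "u \<in> PR (\<lambda>i. tangent_cone (A i) (\<beta> i a))"
      have "sum_\<epsilon> (\<lambda>i. \<beta> i u) \<in> tangent_cone (PR A) a"
        unfolding sum_\<epsilon>_def using u by (intro subspace_sum[OF T] emb) (auto simp: PR_def)
      moreover have "u - sum_\<epsilon> (\<lambda>i. \<beta> i u) \<in> tangent_cone (PR A) a"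
        using u by (intro ker) (auto simp: PR_def \<beta>_diff \<beta>_sum_\<epsilon> intro!: subspace_diff C sum_\<epsilon>_in_C)
      ultimately have "sum_\<epsilon> (\<lambda>i. \<beta> i u) + (u - sum_\<epsilon> (\<lambda>i. \<beta> i u)) \<in> tangent_cone (PR A) a"
        by (rule subspace_add[OF T])
      then show "u \<in> tangent_cone (PR A) a" by simp
    qed
  qed (rule tangent_cone_PR_subset[OF aC])
  show "subspace (tangent_cone (A i) (\<beta> i a))" if i: "i < p"
  proof -
    have "tangent_cone (A i) (\<beta> i a) = \<beta> i ` tangent_cone (PR A) a"
    proof
      show "\<beta> i ` tangent_cone (PR A) a \<subseteq> tangent_cone (A i) (\<beta> i a)"
        unfolding eq using i by (auto simp: PR_def)
      show "tangent_cone (A i) (\<beta> i a) \<subseteq> \<beta> i ` tangent_cone (PR A) a"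
        using emb[OF i] \<beta>\<epsilon>[OF i i] by (metis image_eqI subsetI)
    qed
    then show ?thesis using linear_subspace_image[OF linear_\<beta>[OF i] T] by simp
  qed
qed

text \<open>Project onto \<open>C\<close>, then correct each block. The projection onto
  \<open>C\<close> does not change the blocks, because \<open>C\<close> contains every embedded copy
  and \<open>\<beta> i\<close> is adjoint to \<open>\<epsilon> i\<close>; the corrections are
  orthogonal to \<open>PR L\<close> block by block.\<close>

lemma orth_proj_PR:
  assumes L: "\<And>i. i < p \<Longrightarrow> subspace (L i)"
  shows "orth_proj (PR L) z = orth_proj C z + sum_\<epsilon> (\<lambda>i. orth_proj (L i) (\<beta> i z) - \<beta> i z)"
    (is "_ = ?y")
    and \<beta>_orth_proj_PR: "i < p \<Longrightarrow> \<beta> i (orth_proj (PR L) z) = orth_proj (L i) (\<beta> i z)"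
proof -
  have bC: "\<beta> i (orth_proj C z) = \<beta> i z" if i: "i < p" for i
  proof -
    have "inner (\<beta> i z - \<beta> i (orth_proj C z)) y = 0" for y
      using orth_proj_orthogonal[OF C(1) C(2)[OF i, of y], of z]
      by (simp add: adjoint_\<beta>\<epsilon>[OF i] flip: \<beta>_diff[OF i])
    then show ?thesis by (metis inner_eq_zero_iff right_minus_eq)
  qed
  have b: "\<beta> i ?y = orth_proj (L i) (\<beta> i z)" if "i < p" for i
    using that by (simp add: \<beta>_add \<beta>_sum_\<epsilon> bC)
  have inn: "inner (sum_\<epsilon> y) m = (\<Sum>i<p. inner (y i) (\<beta> i m))" for y m
    unfolding sum_\<epsilon>_def inner_sum_left
    by (intro sum.cong) (auto simp: adjoint_\<beta>\<epsilon> inner_commute[of "\<epsilon> _ _"] inner_commute[of "y _"])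
  show eq: "orth_proj (PR L) z = ?y"
  proof (rule orth_proj_eqI[OF subspace_PR[OF L]])
    show "?y \<in> PR L"
      using b by (auto simp: PR_def intro!: subspace_add sum_\<epsilon>_in_C C orth_proj_in L)
  next
    fix m assume m: "m \<in> PR L"
    have "inner (z - orth_proj C z) m = 0"
      using m by (intro orth_proj_orthogonal C) (simp add: PR_def)
    moreover have "inner (sum_\<epsilon> (\<lambda>i. orth_proj (L i) (\<beta> i z) - \<beta> i z)) m = 0"
      unfolding inn
    proof (intro sum.neutral ballI)
      fix i assume "i \<in> {..<p}"
      then have "inner (\<beta> i z - orth_proj (L i) (\<beta> i z)) (\<beta> i m) = 0"
        using m by (intro orth_proj_orthogonal L) (auto simp: PR_def)
      then show "inner (orth_proj (L i) (\<beta> i z) - \<beta> i z) (\<beta> i m) = 0"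
        by (simp add: inner_diff_left)
    qed
    ultimately show "inner (z - ?y) m = 0"
      by (simp add: inner_diff_left inner_add_left)
  qed simp
  show "i < p \<Longrightarrow> \<beta> i (orth_proj (PR L) z) = orth_proj (L i) (\<beta> i z)"
    using b by (simp add: eq)
qed

lemma orth_proj_PR_tendsto:
  assumes "\<And>i k. i < p \<Longrightarrow> subspace (L k i)" "\<And>i. i < p \<Longrightarrow> subspace (M i)"
    "\<And>i y. i < p \<Longrightarrow> (\<lambda>k. orth_proj (L k i) y) \<longlonglongrightarrow> orth_proj (M i) y"
  shows "(\<lambda>k. orth_proj (PR (L k)) z) \<longlonglongrightarrow> orth_proj (PR M) z"
  using assms by (simp add: orth_proj_PR) (intro tendsto_intros sum_\<epsilon>_tendsto; simp)

text \<open>The limit \<open>M\<close> is not assumed to be a product. The candidate factors are its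
  own block images, and block \<open>i\<close> of the projection depends only on block
  \<open>i\<close> of the argument, so the limit of the block projections can be read off from
  \<open>M\<close>.\<close>

lemma orth_proj_PR_limit:
  assumes L: "\<And>i k. i < p \<Longrightarrow> subspace (L k i)" and M: "subspace M"
    and lim: "\<And>z. (\<lambda>k. orth_proj (PR (L k)) z) \<longlonglongrightarrow> orth_proj M z"
  shows "M = PR (\<lambda>i. \<beta> i ` M)"
    and "i < p \<Longrightarrow> subspace (\<beta> i ` M)"
    and "i < p \<Longrightarrow> (\<lambda>k. orth_proj (L k i) y) \<longlonglongrightarrow> orth_proj (\<beta> i ` M) y"
proof -
  have lim\<beta>: "(\<lambda>k. orth_proj (L k i) (\<beta> i z)) \<longlonglongrightarrow> \<beta> i (orth_proj M z)" if "i < p" for i z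
    using \<beta>_tendsto[OF that lim[of z]] by (simp add: \<beta>_orth_proj_PR[OF L that])
  show sub: "subspace (\<beta> i ` M)" if "i < p" for i
    by (rule linear_subspace_image[OF linear_\<beta>[OF that] M])
  show MPR: "M = PR (\<lambda>i. \<beta> i ` M)"
  proof (intro equalityI subsetI)
    fix z assume z: "z \<in> M"
    have "(\<lambda>k. orth_proj (PR (L k)) z) \<longlonglongrightarrow> z"
      using lim[of z] orth_proj_id[OF M z] by simp
    moreover have "orth_proj (PR (L k)) z \<in> C" for k
      using orth_proj_in[OF subspace_PR, of "L k" z] L by (simp add: PR_def)
    ultimately have "z \<in> C"
      using closed_sequentially[OF closed_subspace[OF C(1)], of "\<lambda>k. orth_proj (PR (L k)) z"] by blast
    then show "z \<in> PR (\<lambda>i. \<beta> i ` M)" using z by (simp add: PR_def)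
  next
    fix z assume "z \<in> PR (\<lambda>i. \<beta> i ` M)"
    then have zC: "z \<in> C" and z: "\<And>i. i < p \<Longrightarrow> \<exists>m\<in>M. \<beta> i z = \<beta> i m"
      by (auto simp: PR_def)
    have lz: "(\<lambda>k. orth_proj (L k i) (\<beta> i z)) \<longlonglongrightarrow> \<beta> i z" if i: "i < p" for i
    proof -
      \<comment> \<open>The vector \<open>m\<close> varies with \<open>i\<close> and may differ from
        \<open>z\<close> in all other blocks; agreement in block \<open>i\<close> suffices for the
        limit in that block.\<close>
      obtain m where m: "m \<in> M" "\<beta> i z = \<beta> i m" using z[OF i] by blast
      then show ?thesis using lim\<beta>[OF i, of m] orth_proj_id[OF M] by simp
    qed
    have "(\<lambda>k. z + sum_\<epsilon> (\<lambda>i. orth_proj (L k i) (\<beta> i z) - \<beta> i z)) \<longlonglongrightarrow> z + sum_\<epsilon> (\<lambda>i. \<beta> i z - \<beta> i z)"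
      by (intro tendsto_intros sum_\<epsilon>_tendsto lz)
    then have "(\<lambda>k. orth_proj (PR (L k)) z) \<longlonglongrightarrow> z"
      by (simp add: orth_proj_PR[OF L] orth_proj_id[OF C(1) zC] sum_\<epsilon>_0)
    then have "orth_proj M z = z" using lim LIMSEQ_unique by blast
    then show "z \<in> M" using orth_proj_in[OF M, of z] by simp
  qed
  show "(\<lambda>k. orth_proj (L k i) y) \<longlonglongrightarrow> orth_proj (\<beta> i ` M) y" if i: "i < p"
  proof -
    have "\<beta> i (orth_proj (PR (\<lambda>i. \<beta> i ` M)) (\<epsilon> i y)) = orth_proj (\<beta> i ` M) (\<beta> i (\<epsilon> i y))"
      using \<beta>_orth_proj_PR[of "\<lambda>i. \<beta> i ` M", OF sub i] by blast
    then have "\<beta> i (orth_proj M (\<epsilon> i y)) = orth_proj (\<beta> i ` M) y"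
      using MPR \<beta>\<epsilon>[OF i i] by simp
    then show ?thesis using lim\<beta>[OF i, of "\<epsilon> i y"] \<beta>\<epsilon>[OF i i] by simp
  qed
qed

end


subsection \<open>Coordinate blocks\<close>

text \<open>The transpose of \<open>block e i\<close>.\<close>

definition place :: "(nat \<Rightarrow> 'n) \<Rightarrow> nat \<Rightarrow> real^3 \<Rightarrow> real^'n::finite" where
  "place e i x = (x $ 1) *\<^sub>R axis (e (3 * i)) 1 + (x $ 2) *\<^sub>R axis (e (3 * i + 1)) 1
     + (x $ 3) *\<^sub>R axis (e (3 * i + 2)) 1"

lemma linear_place: "linear (place e i)"
  by (rule linearI) (simp_all add: place_def algebra_simps)

lemma block_nth [simp]:
  "block e i u $ 1 = u $ e (3 * i)"
  "block e i u $ 2 = u $ e (3 * i + 1)"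
  "block e i u $ 3 = u $ e (3 * i + 2)"
  by (simp_all add: block_def)

lemma linear_block: "linear (block e i)"
  by (rule linearI) (simp_all add: vec_eq_iff forall_3)

lemma inner_block: "inner (block e i u) x = inner u (place e i x)"
  by (simp add: inner_vec_def[of "block e i u"] sum_3 place_def inner_add_right inner_axis mult.commute)

lemma coord3_block: "coord3 (3 * i) = 1" "coord3 (3 * i + 1) = 2" "coord3 (3 * i + 2) = 3"
  by (simp_all add: coord3_def mod_Suc)

locale enumerated_blocks =
  fixes e :: "nat \<Rightarrow> 'n::finite" and p :: nat
  assumes bij: "bij_betw e {..<CARD('n)} UNIV" and p: "3 * p \<le> CARD('n)"
begin

lemma e_eq_iff: "a < CARD('n) \<Longrightarrow> b < CARD('n) \<Longrightarrow> e a = e b \<longleftrightarrow> a = b"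
  using bij by (auto simp: bij_betw_def inj_on_def)

lemma inv_e: "a < CARD('n) \<Longrightarrow> inv_into {..<CARD('n)} e (e a) = a"
  using bij by (simp add: bij_betw_def)

lemma sum_e: "(\<Sum>r\<in>UNIV. f r) = (\<Sum>a<CARD('n). f (e a))"
  by (rule sum.reindex_bij_betw[OF bij, symmetric])

lemma e_cases:
  obtains i j where "i < p" "j < 3" "r = e (3 * i + j)"
  | k where "k < CARD('n) - 3 * p" "r = e (3 * p + k)"
proof -
  have "r \<in> e ` {..<CARD('n)}" using bij by (simp add: bij_betw_def)
  then obtain a where a: "a < CARD('n)" "r = e a" by auto
  show ?thesis
  proof (cases "a < 3 * p")
    case True
    then show ?thesis using that(1)[of "a div 3" "a mod 3"] a by auto
  next
    case False
    then show ?thesis using that(2)[of "a - 3 * p"] a by auto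
  qed
qed

lemma vec_eq_blocksI:
  assumes "\<And>i. i < p \<Longrightarrow> block e i u = block e i v" "rest e p u = rest e p v"
  shows "u = v"
proof -
  have "u $ r = v $ r" for r
  proof (cases rule: e_cases[of r])
    case (1 i j)
    then consider "j = 0" | "j = 1" | "j = 2" by linarith
    then show ?thesis using assms(1)[OF 1(1)] 1(3)
      by cases (simp_all add: vec_eq_iff forall_3)
  next
    case (2 k)
    then show ?thesis using fun_cong[OF assms(2), of k] by (simp add: rest_def)
  qed
  then show ?thesis by (simp add: vec_eq_iff)
qed

lemma block_place:
  assumes "i < p" "j < p"
  shows "block e i (place e j x) = (if i = j then x else 0)"
proof -
  have "3 * i + 2 < CARD('n)" "3 * j + 2 < CARD('n)" using assms p by linarith+
  then show ?thesis
    by (auto simp: vec_eq_iff forall_3 place_def axis_def e_eq_iff)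
qed

lemma rest_place: "i < p \<Longrightarrow> rest e p (place e i x) = (\<lambda>k. 0)"
  using p by (auto simp: rest_def place_def axis_def e_eq_iff fun_eq_iff)

lemma sum_place_block:
  assumes "rest e p u = (\<lambda>k. 0)"
  shows "(\<Sum>i<p. place e i (block e i u)) = u"
proof (rule vec_eq_blocksI)
  show "block e i (\<Sum>i<p. place e i (block e i u)) = block e i u" if "i < p" for i
    using that by (simp add: linear_sum[OF linear_block] block_place)
  have "rest e p (\<Sum>i<p. place e i (block e i u)) = (\<lambda>k. \<Sum>i<p. rest e p (place e i (block e i u)) k)"
    by (auto simp: rest_def fun_eq_iff)
  then show "rest e p (\<Sum>i<p. place e i (block e i u)) = rest e p u"
    by (simp add: rest_place assms)
qed

lemma inner_eq_sum_blocks: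
  assumes "rest e p u = (\<lambda>k. 0)"
  shows "inner u v = (\<Sum>i<p. inner (block e i u) (block e i v))"
proof -
  have "inner u v = inner v (\<Sum>i<p. place e i (block e i u))"
    by (simp add: sum_place_block[OF assms] inner_commute)
  also have "\<dots> = (\<Sum>i<p. inner (block e i u) (block e i v))"
    unfolding inner_sum_right
    by (intro sum.cong) (simp_all add: inner_block[symmetric] inner_commute)
  finally show ?thesis .
qed

definition \<beta> :: "nat \<Rightarrow> (real^'n) \<times> (real^'n) \<Rightarrow> (real^3) \<times> (real^3)" where
  "\<beta> i z = (block e i (fst z), block e i (snd z))"

definition \<epsilon> :: "nat \<Rightarrow> (real^3) \<times> (real^3) \<Rightarrow> (real^'n) \<times> (real^'n)" where
  "\<epsilon> i y = (place e i (fst y), place e i (snd y))"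

text \<open>The constraint of the graph of \<open>QR\<close>: the remaining coordinates vanish in
  the second component and are free in the first.\<close>

definition C :: "((real^'n) \<times> (real^'n)) set" where
  "C = {z. rest e p (snd z) = (\<lambda>k. 0)}"

sublocale orthogonal_blocks p \<beta> \<epsilon> C
proof (rule orthogonal_blocks.intro)
  show "linear (\<beta> i)" if "i < p" for i
    by (rule linearI) (simp_all add: \<beta>_def linear_add[OF linear_block] linear_scale[OF linear_block])
  show "linear (\<epsilon> i)" if "i < p" for i
    by (rule linearI) (simp_all add: \<epsilon>_def linear_add[OF linear_place] linear_scale[OF linear_place])
  show "\<beta> i (\<epsilon> j y) = (if i = j then y else 0)" if "i < p" "j < p" for i j y
    using that by (simp add: \<beta>_def \<epsilon>_def block_place zero_prod_def)
  show "inner (\<beta> i z) y = inner z (\<epsilon> i y)" if "i < p" for i z y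
    by (simp add: \<beta>_def \<epsilon>_def inner_prod_def inner_block)
  show "subspace C"
    by (auto simp: subspace_def C_def rest_def fun_eq_iff)
  show "\<epsilon> i y \<in> C" if "i < p" for i y
    using that by (simp add: C_def \<epsilon>_def rest_place)
qed

lemma mem_PR_iff:
  "(u, w) \<in> PR A \<longleftrightarrow> rest e p w = (\<lambda>k. 0) \<and> (\<forall>i<p. (block e i u, block e i w) \<in> A i)"
  unfolding PR_def by (simp add: C_def \<beta>_def)

lemma gph_QQ: "gph (QQ e p \<F>) = PR (\<lambda>i. gph (Qt \<F>))"
  by (auto simp: gph_def QQ_def QR_def mem_PR_iff)

text \<open>Outside the blocks the subspace consists of the pairs \<open>(r, 0)\<close>, which is
  its own symplectic complement. Therefore the identity block stays in the first slot and the zero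
  block in the second when passing to adjoints.\<close>

lemma adj_PR:
  assumes "\<And>i. i < p \<Longrightarrow> subspace (L i)"
  shows "adj (PR L) = PR (\<lambda>i. adj (L i))"
proof -
  have "(a, b) \<in> adj (PR L) \<longleftrightarrow> (a, b) \<in> PR (\<lambda>i. adj (L i))" for a b
  proof
    assume ab: "(a, b) \<in> adj (PR L)"
    have "b $ e (3 * p + k) = 0" if "k < CARD('n) - 3 * p" for k
    proof -
      have "block e i (axis (e (3 * p + k)) 1) = 0" if "i < p" for i
        using that \<open>k < _\<close> by (auto simp: vec_eq_iff forall_3 axis_def e_eq_iff)
      \<comment> \<open>The remaining coordinates of a first component are free, so each unit vector
        there is a test vector that annihilates a coordinate of \<open>b\<close>.\<close>
      then have "(axis (e (3 * p + k)) 1, 0) \<in> PR L"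
        using subspace_0[OF assms]
        by (auto simp: mem_PR_iff rest_def linear_0[OF linear_block] zero_prod_def)
      then have "inner b (axis (e (3 * p + k)) 1) = inner a 0"
        using ab unfolding mem_adj_iff by blast
      then show ?thesis by (simp add: inner_axis)
    qed
    then have "rest e p b = (\<lambda>k. 0)" by (auto simp: rest_def)
    moreover have "(block e i a, block e i b) \<in> adj (L i)" if i: "i < p" for i
      unfolding mem_adj_iff
    proof (intro allI impI)
      fix u v assume "(u, v) \<in> L i"
      then have "\<epsilon> i (u, v) \<in> PR L"
        using i subspace_0[OF assms] by (auto simp: PR_def C(2) \<beta>\<epsilon>)
      then show "inner (block e i b) u = inner (block e i a) v"
        using ab by (auto simp: mem_adj_iff \<epsilon>_def inner_block)
    qed
    ultimately show "(a, b) \<in> PR (\<lambda>i. adj (L i))" by (simp add: mem_PR_iff)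
  next
    assume ab: "(a, b) \<in> PR (\<lambda>i. adj (L i))"
    show "(a, b) \<in> adj (PR L)"
      unfolding mem_adj_iff
    proof (intro allI impI)
      fix u v assume uv: "(u, v) \<in> PR L"
      \<comment> \<open>Both inner products reduce to blocks because in each of them one argument,
        \<open>b\<close> here and \<open>v\<close> below, vanishes in the remaining
        coordinates.\<close>
      have "inner b u = (\<Sum>i<p. inner (block e i b) (block e i u))"
        using ab by (intro inner_eq_sum_blocks) (simp add: mem_PR_iff)
      also have "\<dots> = (\<Sum>i<p. inner (block e i a) (block e i v))"
        using ab uv by (intro sum.cong) (auto simp: mem_PR_iff mem_adj_iff)
      also have "\<dots> = (\<Sum>i<p. inner (block e i v) (block e i a))"
        by (simp add: inner_commute)
      also have "\<dots> = inner v a"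
        using uv by (intro inner_eq_sum_blocks[symmetric]) (simp add: mem_PR_iff)
      finally show "inner b u = inner a v" by (simp add: inner_commute)
    qed
  qed
  then show ?thesis by auto
qed

section \<open>Block-diagonal matrices as operators on blocks\<close>

lemma blockdiag_nth:
  assumes "a < CARD('n)"
  shows "(blockdiag e p A D *v u) $ e a = (\<Sum>b<CARD('n).
    (if a < 3 * p \<and> b < 3 * p then
       (if a div 3 = b div 3 then A (a div 3) $ coord3 a $ coord3 b else 0)
     else if 3 * p \<le> a \<and> 3 * p \<le> b then D (a - 3 * p) (b - 3 * p)
     else 0) * u $ e b)"
  unfolding matrix_vector_mult_def vec_lambda_beta sum_e
  by (intro sum.cong) (use assms in \<open>simp_all add: blockdiag_def inv_e\<close>)

lemma block_blockdiag:
  assumes "i < p"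
  shows "block e i (blockdiag e p A D *v u) = A i *v block e i u"
proof -
  have "(blockdiag e p A D *v u) $ e a = (A i *v block e i u) $ coord3 a" if a: "a div 3 = i" for a
  proof -
    have a': "a < 3 * p" "a < CARD('n)" using a assms p by auto
    have "(blockdiag e p A D *v u) $ e a
        = (\<Sum>b\<in>{3 * i, 3 * i + 1, 3 * i + 2}. A i $ coord3 a $ coord3 b * u $ e b)"
      unfolding blockdiag_nth[OF a'(2)]
    proof (rule sum.mono_neutral_cong_right)
      show "{3 * i, 3 * i + 1, 3 * i + 2} \<subseteq> {..<CARD('n)}" using assms p by auto
    qed (use a a' assms in auto)
    also have "\<dots> = (A i *v block e i u) $ coord3 a"
      by (simp add: matrix_vector_mult_def sum_3 coord3_block[simplified])
    finally show ?thesis .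
  qed
  from this[of "3 * i"] this[of "3 * i + 1"] this[of "3 * i + 2"] show ?thesis
    by (simp add: vec_eq_iff forall_3 coord3_block[simplified])
qed

lemma rest_blockdiag_Id: "rest e p (blockdiag e p A Id_entries *v u) = rest e p u"
proof -
  have "(blockdiag e p A Id_entries *v u) $ e (3 * p + k) = u $ e (3 * p + k)"
    if k: "k < CARD('n) - 3 * p" for k
  proof -
    have k': "3 * p + k < CARD('n)" using k by linarith
    have "(blockdiag e p A Id_entries *v u) $ e (3 * p + k)
        = (\<Sum>b\<in>{3 * p + k}. u $ e b)"
      unfolding blockdiag_nth[OF k']
      by (rule sum.mono_neutral_cong_right) (use k' in \<open>auto simp: Id_entries_def\<close>)
    then show ?thesis by simp
  qed
  then show ?thesis by (auto simp: rest_def fun_eq_iff)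
qed

lemma rest_blockdiag_Zero: "rest e p (blockdiag e p A Zero_entries *v u) = (\<lambda>k. 0)"
proof -
  have "(blockdiag e p A Zero_entries *v u) $ e (3 * p + k) = 0" if "k < CARD('n) - 3 * p" for k
    using that by (subst blockdiag_nth) (auto simp: Zero_entries_def intro!: sum.neutral)
  then show ?thesis by (auto simp: rest_def fun_eq_iff)
qed

lemma rge_blockdiag:
  "rge (blockdiag e p A Id_entries) (blockdiag e p B Zero_entries) = PR (\<lambda>i. rge (A i) (B i))"
proof -
  have "(u, w) \<in> rge (blockdiag e p A Id_entries) (blockdiag e p B Zero_entries)"
    if uw: "(u, w) \<in> PR (\<lambda>i. rge (A i) (B i))" for u w
  proof -
    have "\<forall>i. \<exists>x. i < p \<longrightarrow> block e i u = A i *v x \<and> block e i w = B i *v x"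
      using uw by (auto simp: mem_PR_iff rge_def image_iff)
    then obtain x where x: "\<And>i. i < p \<Longrightarrow> block e i u = A i *v x i \<and> block e i w = B i *v x i"
      by metis
    \<comment> \<open>The preimage has the blockwise preimages \<open>x i\<close> in its blocks and
      agrees with \<open>u\<close> elsewhere, where the first matrix acts as the identity.\<close>
    define y where "y = u + (\<Sum>i<p. place e i (x i - block e i u))"
    have by': "block e i y = x i" if "i < p" for i
      using that
      by (simp add: y_def linear_add[OF linear_block] linear_sum[OF linear_block] block_place)
    have "rest e p y k = rest e p u k + (\<Sum>i<p. rest e p (place e i (x i - block e i u)) k)" for k
      by (auto simp: rest_def y_def)
    then have ry: "rest e p y = rest e p u" by (simp add: rest_place fun_eq_iff)
    have "u = blockdiag e p A Id_entries *v y"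
      by (rule vec_eq_blocksI) (simp_all add: block_blockdiag by' x ry rest_blockdiag_Id)
    moreover have "w = blockdiag e p B Zero_entries *v y"
      using uw by (intro vec_eq_blocksI)
        (simp_all add: block_blockdiag by' x rest_blockdiag_Zero mem_PR_iff)
    ultimately show ?thesis by (auto simp: rge_def)
  qed
  moreover have "rge (blockdiag e p A Id_entries) (blockdiag e p B Zero_entries)
      \<subseteq> PR (\<lambda>i. rge (A i) (B i))"
    by (auto simp: rge_def mem_PR_iff rest_blockdiag_Zero block_blockdiag)
  ultimately show ?thesis by auto
qed

text \<open>Instead of adding up dimensions, the product is parametrized injectively by
  \<open>real^'n\<close>: injective pairs handle the blocks and the identity block the remaining
  coordinates.\<close>

lemma PR_Zspace:
  assumes "\<And>i. i < p \<Longrightarrow> L i \<in> Zspace"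
  shows "PR L \<in> Zspace"
proof -
  from Zspace_family_rge[of p L, OF assms]
  obtain A B where AB: "\<And>i. i < p \<Longrightarrow> L i = rge (A i) (B i)"
    "\<And>i. i < p \<Longrightarrow> inj (\<lambda>u. (A i *v u, B i *v u))" by auto
  have "inj (\<lambda>u. (blockdiag e p A Id_entries *v u, blockdiag e p B Zero_entries *v u))"
  proof (rule injI)
    fix u v
    assume "(blockdiag e p A Id_entries *v u, blockdiag e p B Zero_entries *v u)
      = (blockdiag e p A Id_entries *v v, blockdiag e p B Zero_entries *v v)"
    then have eq: "blockdiag e p A Id_entries *v u = blockdiag e p A Id_entries *v v"
      "blockdiag e p B Zero_entries *v u = blockdiag e p B Zero_entries *v v" by auto
    show "u = v"
    proof (rule vec_eq_blocksI)
      show "block e i u = block e i v" if "i < p" for i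
      proof (rule injD[OF AB(2)[OF that]])
        show "(A i *v block e i u, B i *v block e i u) = (A i *v block e i v, B i *v block e i v)"
          using eq by (simp flip: block_blockdiag[OF that, of A Id_entries]
              block_blockdiag[OF that, of B Zero_entries])
      qed
      show "rest e p u = rest e p v"
        using eq(1) by (metis rest_blockdiag_Id)
    qed
  qed
  then have "PR (\<lambda>i. rge (A i) (B i)) \<in> Zspace"
    unfolding rge_blockdiag[symmetric] by (rule rge_Zspace)
  moreover have "PR (\<lambda>i. rge (A i) (B i)) = PR L" by (auto simp: PR_def AB(1))
  ultimately show ?thesis by simp
qed

end


subsection \<open>The friction mapping of one contact point\<close>

lemma normal_cone_nonneg_reals:
  "s \<in> normal_cone {0::real..} x \<longleftrightarrow> 0 \<le> x \<and> s \<le> 0 \<and> (0 < x \<longrightarrow> s = 0)"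
proof
  assume "s \<in> normal_cone {0..} x"
  then have x: "0 \<le> x" and s: "\<And>y. 0 \<le> y \<Longrightarrow> s * (y - x) \<le> 0"
    by (auto simp: normal_cone_def split: if_splits)
  have "s \<le> 0" using s[of "x + 1"] x by simp
  moreover have "s = 0" if "0 < x"
    using s[of 0] that \<open>s \<le> 0\<close> by (simp add: zero_le_mult_iff)
  ultimately show "0 \<le> x \<and> s \<le> 0 \<and> (0 < x \<longrightarrow> s = 0)" using x by blast
next
  assume "0 \<le> x \<and> s \<le> 0 \<and> (0 < x \<longrightarrow> s = 0)"
  then show "s \<in> normal_cone {0..} x"
    by (cases "x = 0") (auto simp: normal_cone_def mult_nonpos_nonneg)
qed

lemma subdifferential_norm_0: "subdifferential norm (0::'a::real_inner) = cball 0 1"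
proof -
  have "norm s \<le> 1" if "\<forall>y. inner s y \<le> norm y" for s :: 'a
  proof -
    have "norm s * norm s \<le> norm s * 1"
      using that[rule_format, of s] by (simp add: power2_norm_eq_inner[symmetric] power2_eq_square)
    then show ?thesis by (cases "s = 0") auto
  qed
  moreover have "inner s y \<le> norm y" if "norm s \<le> 1" for s y :: 'a
  proof -
    have "inner s y \<le> norm s * norm y" by (rule norm_cauchy_schwarz)
    also have "\<dots> \<le> 1 * norm y" using that by (intro mult_right_mono) auto
    finally show ?thesis by simp
  qed
  ultimately show ?thesis by (auto simp: subdifferential_def)
qed

text \<open>The test point 0 gives \<open>inner s x \<ge> norm x\<close>, the test point
  \<open>x + s\<close> gives \<open>norm s \<le> 1\<close>. Expanding the squared distance from
  \<open>s\<close> to the normalized \<open>x\<close> then bounds it by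
  \<open>1 - 2 + 1 = 0\<close>.\<close>

lemma subdifferential_norm:
  fixes x :: "'a::real_inner"
  assumes "x \<noteq> 0"
  shows "subdifferential norm x = {x /\<^sub>R norm x}"
proof -
  have "s = x /\<^sub>R norm x" if s: "s \<in> subdifferential norm x" for s
  proof -
    have s: "norm x + inner s (y - x) \<le> norm y" for y
      using s by (simp add: subdifferential_def)
    have sx: "norm x \<le> inner s x" using s[of 0] by simp
    have "norm x + inner s s \<le> norm (x + s)" using s[of "x + s"] by simp
    also have "\<dots> \<le> norm x + norm s" by (rule norm_triangle_ineq)
    finally have "norm s * norm s \<le> norm s * 1"
      by (simp add: power2_norm_eq_inner[symmetric] power2_eq_square)
    then have "norm s \<le> 1" by (cases "s = 0") auto
    then have ss: "inner s s \<le> 1"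
      by (simp add: power2_norm_eq_inner[symmetric] power_le_one)
    have "inner (s - x /\<^sub>R norm x) (s - x /\<^sub>R norm x)
        = inner s s - 2 * (inner s x / norm x) + inner x x / (norm x * norm x)"
      by (simp add: inner_diff_left inner_diff_right inner_commute divide_inverse algebra_simps)
    moreover have "inner x x / (norm x * norm x) = 1"
      using assms by (simp add: power2_norm_eq_inner[symmetric] power2_eq_square)
    moreover have "1 \<le> inner s x / norm x" using sx assms by (simp add: le_divide_eq)
    ultimately have "inner (s - x /\<^sub>R norm x) (s - x /\<^sub>R norm x) \<le> 0" using ss by linarith
    then show ?thesis by (metis inner_eq_zero_iff inner_ge_zero order_antisym right_minus_eq)
  qed
  moreover have "x /\<^sub>R norm x \<in> subdifferential norm x"
  proof -
    have "inner x y / norm x \<le> norm y" for y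
      using assms norm_cauchy_schwarz[of x y] by (simp add: divide_le_eq mult.commute)
    moreover have "inner x x / norm x = norm x"
      using assms by (simp add: power2_norm_eq_inner[symmetric] power2_eq_square)
    ultimately show ?thesis
      by (simp add: subdifferential_def inner_diff_right divide_inverse mult.commute right_diff_distrib)
  qed
  ultimately show ?thesis by blast
qed

lemma image_scaleR_cball_1:
  fixes g :: "'a::real_normed_vector"
  assumes "0 \<le> c"
  shows "g \<in> (\<lambda>s. c *\<^sub>R s) ` cball 0 1 \<longleftrightarrow> norm g \<le> c"
proof (cases "c = 0")
  case True
  then show ?thesis by (auto simp: image_def intro!: exI[of _ 0])
next
  case False
  then show ?thesis using assms cball_scale[of c "0::'a" 1] by simp
qed

lemma norm_scaleR_unit: "x \<noteq> 0 \<Longrightarrow> norm (c *\<^sub>R (x /\<^sub>R norm x)) = \<bar>c\<bar>"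
  for x :: "'a::real_normed_vector"
  by (simp add: abs_mult)

section \<open>Tangential and normal components in three dimensions\<close>

lemma linear_fst2: "linear fst2"
  by (rule linearI) (simp_all add: fst2_def vec_eq_iff forall_2)

lemma fst2_nth [simp]: "fst2 v $ 1 = v $ 1" "fst2 v $ 2 = v $ 2"
  by (simp_all add: fst2_def)

lemma fst2_0 [simp]: "fst2 0 = 0"
  by (rule linear_0[OF linear_fst2])

definition emb2 :: "real^2 \<Rightarrow> real^3" where
  "emb2 x = vector [x $ 1, x $ 2, 0]"

lemma emb2_nth [simp]: "emb2 x $ 1 = x $ 1" "emb2 x $ 2 = x $ 2" "emb2 x $ 3 = 0"
  by (simp_all add: emb2_def)

lemma linear_emb2: "linear emb2"
  by (rule linearI) (simp_all add: vec_eq_iff forall_3)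

lemma fst2_emb2 [simp]: "fst2 (emb2 x) = x"
  by (simp add: vec_eq_iff forall_2)

lemma axis_3_nth [simp]:
  "axis (3::3) (1::real) $ 1 = 0" "axis (3::3) (1::real) $ 2 = 0" "axis (3::3) (1::real) $ 3 = 1"
  by (simp_all add: axis_def)

lemma fst2_axis_3 [simp]: "fst2 (axis 3 1) = 0"
  by (simp add: vec_eq_iff forall_2)

lemma vec3_eq_iff: "v = w \<longleftrightarrow> fst2 v = fst2 w \<and> v $ 3 = w $ 3" for v w :: "real^3"
  by (auto simp: vec_eq_iff forall_3 forall_2)

lemmas linear_fst2_simps = linear_add[OF linear_fst2] linear_diff[OF linear_fst2]
  linear_scale[OF linear_fst2] linear_neg[OF linear_fst2]

lemma continuous_on_fst2 [continuous_intros]: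
  "continuous_on S f \<Longrightarrow> continuous_on S (\<lambda>z. fst2 (f z))"
  using linear_fst2 bounded_linear.continuous_on linear_conv_bounded_linear by blast

context
  fixes \<F> :: real
  assumes \<F>: "0 < \<F>"
begin

text \<open>The radius \<open>- (\<F> * w $ 3)\<close> is nonnegative because
  \<open>w $ 3 \<le> 0\<close>, so at zero tangential velocity the scaled unit ball is the disc of
  that radius; otherwise the force is the single boundary point opposing the motion up to the sign
  convention of the mapping, as in Coulomb's law.\<close>

lemma mem_gph_Qt:
  "(v, w) \<in> gph (Qt \<F>) \<longleftrightarrow> 0 \<le> v $ 3 \<and> w $ 3 \<le> 0 \<and> (0 < v $ 3 \<longrightarrow> w $ 3 = 0) \<and>
    (if fst2 v = 0 then norm (fst2 w) \<le> - (\<F> * w $ 3)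
     else fst2 w = - (\<F> * w $ 3) *\<^sub>R (fst2 v /\<^sub>R norm (fst2 v)))"
proof -
  have "fst2 w \<in> (\<lambda>s. - (\<F> * w $ 3) *\<^sub>R s) ` subdifferential norm (fst2 v) \<longleftrightarrow>
    (if fst2 v = 0 then norm (fst2 w) \<le> - (\<F> * w $ 3)
     else fst2 w = - (\<F> * w $ 3) *\<^sub>R (fst2 v /\<^sub>R norm (fst2 v)))" if "w $ 3 \<le> 0"
  proof (cases "fst2 v = 0")
    case True
    have "0 \<le> - (\<F> * w $ 3)" using that \<F> by (simp add: mult_nonneg_nonpos)
    from image_scaleR_cball_1[OF this] True show ?thesis
      by (simp add: subdifferential_norm_0 del: scaleR_minus_left)
  qed (auto simp: subdifferential_norm)
  then show ?thesis
    by (auto simp: gph_def Qt_def normal_cone_nonneg_reals)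
qed

lemma gph_Qt_norm_le:
  assumes "(v, w) \<in> gph (Qt \<F>)"
  shows "norm (fst2 w) \<le> - (\<F> * w $ 3)"
proof (cases "fst2 v = 0")
  case False
  then have "norm (fst2 w) = \<bar>\<F> * w $ 3\<bar>"
    using assms norm_scaleR_unit[of "fst2 v" "- (\<F> * w $ 3)"]
    by (simp add: mem_gph_Qt del: norm_scaleR)
  moreover have "\<F> * w $ 3 \<le> 0" using assms \<F> by (simp add: mem_gph_Qt mult_nonneg_nonpos)
  ultimately show ?thesis by simp
qed (use assms in \<open>simp add: mem_gph_Qt\<close>)

text \<open>The inequality \<open>0 < v $ 3\<close> persists nearby and forces \<open>w = 0\<close>,
  so the graph is locally a flat piece. Its tangent space does not depend on \<open>v\<close>, which
  makes constant sequences of tangent spaces available.\<close>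

lemma tangent_cone_Qt_contactless:
  assumes "0 < v $ 3"
  shows "(v, 0) \<in> gph (Qt \<F>)" (is ?a)
    and "tangent_cone (gph (Qt \<F>)) (v, 0) = range (\<lambda>h. (h, 0))" (is ?b)
    and "derivable_at (gph (Qt \<F>)) (v, 0)" (is ?c)
    and "subspace (tangent_cone (gph (Qt \<F>)) (v, 0))" (is ?s)
    and "dim (tangent_cone (gph (Qt \<F>)) (v, 0)) = 3" (is ?d)
proof -
  show a: ?a using assms by (simp add: mem_gph_Qt)
  define U :: "((real^3) \<times> (real^3)) set" where "U = {z. 0 < fst z $ 3}"
  have "open U" unfolding U_def by (intro open_Collect_less continuous_intros)
  then have "\<forall>\<^sub>F z in nhds (v, 0). z \<in> U"
    using assms by (intro eventually_nhds_in_open) (auto simp: U_def)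
  then have chart: "\<forall>\<^sub>F z in nhds (v, 0). z \<in> gph (Qt \<F>) \<longleftrightarrow> z = (fst z, 0)"
  proof eventually_elim
    case (elim z)
    then show ?case
      by (cases z) (auto simp: U_def mem_gph_Qt vec3_eq_iff[of _ 0] split: if_splits)
  qed
  have d: "((\<lambda>q. (q, 0::real^3)) has_derivative (\<lambda>h. (h, 0))) (at (fst (v, 0::real^3)))"
    by (auto intro!: derivative_eq_intros)
  note * = tangent_cone_chart[OF d linear_fst _ a chart]
  show ?b ?c ?s using * by simp_all
  show ?d using *(4) by simp
qed

text \<open>Both strict inequalities persist nearby. A nonzero tangential velocity would put the
  force on the boundary of the friction cone, and \<open>w $ 3 < 0\<close> excludes separation, so
  the first component must be 0.\<close>

lemma tangent_cone_Qt_stick: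
  assumes w: "w $ 3 < 0" "norm (fst2 w) < - (\<F> * w $ 3)"
  shows "(0, w) \<in> gph (Qt \<F>)" (is ?a)
    and "tangent_cone (gph (Qt \<F>)) (0, w) = range (\<lambda>h. (0, h))" (is ?b)
    and "derivable_at (gph (Qt \<F>)) (0, w)" (is ?c)
    and "subspace (tangent_cone (gph (Qt \<F>)) (0, w))" (is ?s)
    and "dim (tangent_cone (gph (Qt \<F>)) (0, w)) = 3" (is ?d)
proof -
  show a: ?a using w by (simp add: mem_gph_Qt)
  define U :: "((real^3) \<times> (real^3)) set"
    where "U = {z. snd z $ 3 < 0} \<inter> {z. norm (fst2 (snd z)) < - (\<F> * snd z $ 3)}"
  have "open U" unfolding U_def by (intro open_Int open_Collect_less continuous_intros)
  then have "\<forall>\<^sub>F z in nhds (0, w). z \<in> U"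
    using w by (intro eventually_nhds_in_open) (auto simp: U_def)
  then have chart: "\<forall>\<^sub>F z in nhds (0, w). z \<in> gph (Qt \<F>) \<longleftrightarrow> z = (0, snd z)"
  proof eventually_elim
    case (elim z)
    obtain x y where z: "z = (x, y)" by fastforce
    have xy: "y $ 3 < 0" "norm (fst2 y) < - (\<F> * y $ 3)" using elim by (auto simp: U_def z)
    have "fst2 y \<noteq> - (\<F> * y $ 3) *\<^sub>R (fst2 x /\<^sub>R norm (fst2 x))" if "fst2 x \<noteq> 0"
    proof
      assume "fst2 y = - (\<F> * y $ 3) *\<^sub>R (fst2 x /\<^sub>R norm (fst2 x))"
      then have "norm (fst2 y) = \<bar>\<F> * y $ 3\<bar>"
        using norm_scaleR_unit[OF that, of "- (\<F> * y $ 3)"] by (simp del: norm_scaleR)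
      then show False using xy(2) by linarith
    qed
    then show ?case
      using xy by (auto simp: z mem_gph_Qt vec3_eq_iff[of x 0])
  qed
  have d: "((\<lambda>q. (0::real^3, q)) has_derivative (\<lambda>h. (0, h))) (at (snd (0::real^3, w)))"
    by (auto intro!: derivative_eq_intros)
  note * = tangent_cone_chart[OF d linear_snd _ a chart]
  show ?b ?c ?s using * by simp_all
  show ?d using *(4) by simp
qed

lemma tangent_cone_Qt_slip:
  assumes z: "(v, w) \<in> gph (Qt \<F>)" and w: "w $ 3 < 0" and v: "fst2 v \<noteq> 0"
  shows "derivable_at (gph (Qt \<F>)) (v, w)" (is ?c)
    and "subspace (tangent_cone (gph (Qt \<F>)) (v, w))" (is ?s)
    and "dim (tangent_cone (gph (Qt \<F>)) (v, w)) = 3" (is ?d)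
proof -
  \<comment> \<open>The free parameters in \<open>q\<close> are the two tangential velocities and,
    in the third slot, the normal component of \<open>w\<close>. The normal velocity is 0 and the
    tangential force is determined; smoothness rests on the tangential velocity being
    nonzero.\<close>
  define \<phi> :: "real^3 \<Rightarrow> (real^3) \<times> (real^3)" where "\<phi> = (\<lambda>q. (emb2 (fst2 q),
    emb2 (- (\<F> * q $ 3) *\<^sub>R (fst2 q /\<^sub>R norm (fst2 q))) + (q $ 3) *\<^sub>R axis 3 1))"
  define \<pi> :: "(real^3) \<times> (real^3) \<Rightarrow> real^3"
    where "\<pi> = (\<lambda>z. emb2 (fst2 (fst z)) + (snd z $ 3) *\<^sub>R axis 3 1)"
  define U :: "((real^3) \<times> (real^3)) set"
    where "U = {z. snd z $ 3 < 0} \<inter> {z. fst2 (fst z) \<noteq> 0}"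
  have "open U" unfolding U_def by (intro open_Int open_Collect_less open_Collect_neq continuous_intros)
  then have "\<forall>\<^sub>F z in nhds (v, w). z \<in> U"
    using v w by (intro eventually_nhds_in_open) (auto simp: U_def)
  then have chart: "\<forall>\<^sub>F z in nhds (v, w). z \<in> gph (Qt \<F>) \<longleftrightarrow> z = \<phi> (\<pi> z)"
  proof eventually_elim
    case (elim z)
    then show ?case
      by (cases z) (auto simp: U_def \<phi>_def \<pi>_def mem_gph_Qt vec3_eq_iff linear_fst2_simps)
  qed
  have \<pi>: "linear \<pi>"
    by (rule linearI) (simp_all add: \<pi>_def vec3_eq_iff linear_fst2_simps algebra_simps)
  have \<pi>\<phi>: "\<pi> (\<phi> q) = q" for q
    by (simp add: \<phi>_def \<pi>_def vec3_eq_iff linear_fst2_simps)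
  have bl: "bounded_linear emb2" "bounded_linear fst2"
    using linear_emb2 linear_fst2 by (simp_all add: linear_conv_bounded_linear)
  let ?q = "\<pi> (v, w)"
  have q: "fst2 ?q \<noteq> 0" using v by (simp add: \<pi>_def linear_fst2_simps)
  have d3: "(\<lambda>q. q $ 3) differentiable (at ?q)"
    by (rule bounded_linear_imp_differentiable[OF bounded_linear_vec_nth])
  have d2: "fst2 differentiable (at ?q)"
    by (rule bounded_linear_imp_differentiable[OF bl(2)])
  have de: "emb2 differentiable (at x)" for x
    by (rule bounded_linear_imp_differentiable[OF bl(1)])
  have dn: "(\<lambda>q. norm (fst2 q)) differentiable (at ?q)"
    by (rule differentiable_compose[OF differentiable_norm_at[OF q] d2])
  have di: "(\<lambda>q. inverse (norm (fst2 q))) differentiable (at ?q)"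
    by (rule differentiable_inverse[OF dn]) (use q in simp)
  have du: "(\<lambda>q. - (\<F> * q $ 3) *\<^sub>R (fst2 q /\<^sub>R norm (fst2 q))) differentiable (at ?q)"
    by (rule differentiable_scaleR[OF differentiable_minus[OF differentiable_mult[OF differentiable_const d3]]
          differentiable_scaleR[OF di d2]])
  have "\<phi> differentiable (at ?q)"
    unfolding \<phi>_def
    by (rule differentiable_Pair[OF differentiable_compose[OF de d2]
          differentiable_add[OF differentiable_compose[OF de du]
            differentiable_scaleR[OF d3 differentiable_const]]])
  then obtain \<phi>' where d: "(\<phi> has_derivative \<phi>') (at (\<pi> (v, w)))"
    unfolding differentiable_def by blast
  note * = tangent_cone_chart[OF d \<pi> \<pi>\<phi> z chart]
  show ?c ?s using * by simp_all
  show ?d using *(4) by simp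
qed

text \<open>In each case a one-sided constraint is active: \<open>v $ 3 \<ge> 0\<close> at vanishing
  force, or the friction cone at a point of its boundary. The inward direction is tangent and its
  negative is not.\<close>

lemma tangent_cone_Qt_not_subspace:
  assumes z: "(v, w) \<in> gph (Qt \<F>)" and v3: "v $ 3 = 0"
    and w: "w $ 3 = 0 \<or> w $ 3 < 0 \<and> fst2 v = 0 \<and> norm (fst2 w) = - (\<F> * w $ 3)"
  shows "\<not> subspace (tangent_cone (gph (Qt \<F>)) (v, w))"
proof
  assume T: "subspace (tangent_cone (gph (Qt \<F>)) (v, w))"
  show False
  proof (cases "w $ 3 = 0")
    case True
    then have w0: "w = 0" using z by (auto simp: mem_gph_Qt vec3_eq_iff split: if_splits)
    have "(axis 3 1, 0) \<in> tangent_cone (gph (Qt \<F>)) (v, w)"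
    proof (rule tangent_coneI[OF _ null_sequence])
      show "(v, w) + (1 / (1 + real k)) *\<^sub>R (axis 3 1, 0) \<in> gph (Qt \<F>)" for k
        by (simp add: mem_gph_Qt w0 v3)
    qed simp_all
    then have "- (axis 3 1, 0) \<in> tangent_cone (gph (Qt \<F>)) (v, w)"
      by (rule subspace_neg[OF T])
    then obtain t x where t: "\<And>k::nat. 0 < t k" and x: "x \<longlonglongrightarrow> - (axis 3 1, 0)"
      and g: "\<And>k. (v, w) + t k *\<^sub>R x k \<in> gph (Qt \<F>)"
      by (rule tangent_coneE) blast
    have "0 \<le> fst (x k) $ 3" for k
      using g[of k] t[of k] by (cases "x k") (auto simp: mem_gph_Qt v3 zero_le_mult_iff)
    then have "0 \<le> fst (- (axis 3 (1::real), 0::real^3)) $ (3::3)"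
      by (intro LIMSEQ_le_const[OF tendsto_vec_nth[OF tendsto_fst[OF x]]]) auto
    then show False by simp
  next
    case False
    define g where "g = fst2 w"
    have w: "w $ 3 < 0" "fst2 v = 0" "norm g = - (\<F> * w $ 3)" using w False by (auto simp: g_def)
    then have v: "v = 0" using v3 by (simp add: vec3_eq_iff)
    have g0: "0 < norm g" using w \<F> by (simp add: mult_pos_neg)
    have "(0, - emb2 g) \<in> tangent_cone (gph (Qt \<F>)) (v, w)"
    proof (rule tangent_coneI[OF _ null_sequence])
      fix k
      define t where "t = 1 / (1 + real k)"
      \<comment> \<open>Steps of size at most 1 keep \<open>(1 - t) *\<^sub>R g\<close> within the
        disc of radius \<open>norm g\<close>.\<close>
      have t: "0 \<le> t" "t \<le> 1" by (auto simp: t_def)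
      have "norm (g - t *\<^sub>R g) = norm ((1 - t) *\<^sub>R g)" by (simp add: algebra_simps)
      also have "\<dots> \<le> norm g" using t by (simp add: mult_left_le_one_le)
      finally have "(v, w) + t *\<^sub>R (0, - emb2 g) \<in> gph (Qt \<F>)"
        using w by (simp add: mem_gph_Qt v linear_fst2_simps flip: g_def)
      then show "(v, w) + (1 / (1 + real k)) *\<^sub>R (0, - emb2 g) \<in> gph (Qt \<F>)"
        by (simp add: t_def)
    qed simp_all
    then have "- (0, - emb2 g) \<in> tangent_cone (gph (Qt \<F>)) (v, w)"
      by (rule subspace_neg[OF T])
    then obtain t x where t: "\<And>k::nat. 0 < t k" and x: "x \<longlonglongrightarrow> - (0, - emb2 g)"
      and x': "\<And>k. (v, w) + t k *\<^sub>R x k \<in> gph (Qt \<F>)"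
      by (rule tangent_coneE) blast
    \<comment> \<open>This is the linearized friction cone constraint, obtained from Cauchy-Schwarz
      against \<open>g\<close> after dividing by the step size. In the limit the outward direction
      would give \<open>inner g g \<le> 0\<close>.\<close>
    have "inner g (fst2 (snd (x k))) + \<F> * norm g * snd (x k) $ 3 \<le> 0" for k
    proof -
      obtain a b where ab: "x k = (a, b)" by fastforce
      have "norm (fst2 (w + t k *\<^sub>R b)) \<le> - (\<F> * (w + t k *\<^sub>R b) $ 3)"
        using gph_Qt_norm_le[of "v + t k *\<^sub>R a" "w + t k *\<^sub>R b"] x'[of k] ab by simp
      then have n: "norm (g + t k *\<^sub>R fst2 b) \<le> norm g - \<F> * t k * b $ 3"
        using w(3) by (simp add: linear_fst2_simps g_def algebra_simps)
      have "inner g g + t k * inner g (fst2 b) = inner g (g + t k *\<^sub>R fst2 b)"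
        by (simp add: inner_add_right)
      also have "\<dots> \<le> norm g * norm (g + t k *\<^sub>R fst2 b)" by (rule norm_cauchy_schwarz)
      also have "\<dots> \<le> norm g * (norm g - \<F> * t k * b $ 3)" by (intro mult_left_mono n) simp
      finally have "t k * (inner g (fst2 b) + \<F> * norm g * b $ 3) \<le> 0"
        by (simp add: power2_norm_eq_inner[symmetric] power2_eq_square algebra_simps)
      then show ?thesis using t[of k] ab by (simp add: mult_le_0_iff)
    qed
    moreover have "(\<lambda>k. inner g (fst2 (snd (x k))) + \<F> * norm g * snd (x k) $ 3) \<longlonglongrightarrow>
        inner g (fst2 (emb2 g)) + \<F> * norm g * emb2 g $ 3"
    proof -
      have "(\<lambda>k. snd (x k)) \<longlonglongrightarrow> emb2 g" using tendsto_snd[OF x] by simp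
      then show ?thesis
        using linear_fst2 unfolding linear_conv_bounded_linear
        by (intro tendsto_intros bounded_linear.tendsto[of fst2])
    qed
    ultimately have "inner g (fst2 (emb2 g)) + \<F> * norm g * emb2 g $ 3 \<le> 0"
      by (intro LIMSEQ_le_const2) auto
    then show False using g0 by (simp add: power2_norm_eq_inner[symmetric])
  qed
qed

lemma gph_Qt_cases:
  assumes z: "(v, w) \<in> gph (Qt \<F>)"
  obtains (contactless) "0 < v $ 3" "w = 0"
  | (slip) "w $ 3 < 0" "fst2 v \<noteq> 0"
  | (stick) "v = 0" "w $ 3 < 0" "norm (fst2 w) < - (\<F> * w $ 3)"
  | (kink) "v $ 3 = 0" "w $ 3 = 0 \<or> w $ 3 < 0 \<and> fst2 v = 0 \<and> norm (fst2 w) = - (\<F> * w $ 3)"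
proof -
  have v3: "0 \<le> v $ 3" "w $ 3 \<le> 0" "0 < v $ 3 \<Longrightarrow> w $ 3 = 0" using z by (auto simp: mem_gph_Qt)
  note n = gph_Qt_norm_le[OF z]
  show ?thesis
  proof (cases "0 < v $ 3")
    case True
    then show ?thesis using contactless v3(3) n by (simp add: vec3_eq_iff)
  next
    case False
    then have v30: "v $ 3 = 0" using v3 by simp
    show ?thesis
    proof (cases "w $ 3 = 0 \<or> fst2 v \<noteq> 0")
      case True
      then show ?thesis using kink v30 slip v3(2) by fastforce
    next
      case False
      then have "v = 0" "w $ 3 < 0" using v30 v3(2) by (auto simp: vec3_eq_iff)
      then show ?thesis using stick kink n by fastforce
    qed
  qed
qed

lemma tangent_cone_Qt_subspace:
  assumes z: "z \<in> gph (Qt \<F>)" and T: "subspace (tangent_cone (gph (Qt \<F>)) z)"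
  shows "derivable_at (gph (Qt \<F>)) z \<and> dim (tangent_cone (gph (Qt \<F>)) z) = 3"
proof -
  obtain v w where [simp]: "z = (v, w)" by fastforce
  from z have "(v, w) \<in> gph (Qt \<F>)" by simp
  then show ?thesis
    by (cases rule: gph_Qt_cases)
      (use z T tangent_cone_Qt_contactless[of v] tangent_cone_Qt_slip[of v w]
        tangent_cone_Qt_stick[of w] tangent_cone_Qt_not_subspace[of v w] in auto)
qed

text \<open>Tangent spaces equal to \<open>L\<close> along the sequence are at distance 0 from
  \<open>L\<close>, so \<open>L\<close> itself is a limit.\<close>

lemma scd_S_const:
  assumes "zs \<longlonglongrightarrow> z" "\<And>k. zs k \<in> scd_O F" "\<And>k. tangent_cone (gph F) (zs k) = L"
  shows "scd_S F z \<noteq> {}"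
proof -
  have "L \<in> Zspace" using assms(2,3) by (auto simp: scd_O_def)
  moreover have "dist_Z L L = 0" by (simp add: dist_Z_def onorm_zero)
  ultimately have "L \<in> scd_S F z" using assms by (auto simp: scd_S_def intro!: exI[of _ zs])
  then show ?thesis by blast
qed

lemma scd_S_Qt_nonempty:
  assumes z: "z \<in> gph (Qt \<F>)"
  shows "scd_S (Qt \<F>) z \<noteq> {}"
proof (cases "z \<in> scd_O (Qt \<F>)")
  case True
  then show ?thesis by (intro scd_S_const[of "\<lambda>k. z"]) auto
next
  case False
  obtain v w where zvw: "z = (v, w)" by fastforce
  have nT: "\<not> subspace (tangent_cone (gph (Qt \<F>)) z)"
    using False z tangent_cone_Qt_subspace[OF z] by (auto simp: scd_O_def Zspace_def)
  have vw: "(v, w) \<in> gph (Qt \<F>)" using z zvw by simp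
  define t where "t = (\<lambda>k. 1 / (1 + real k))"
  have t: "t \<longlonglongrightarrow> 0" "0 < t k" "t k \<le> 1" for k using null_sequence by (auto simp: t_def)
  from vw show ?thesis
  proof (cases rule: gph_Qt_cases)
    case contactless
    then show ?thesis using nT tangent_cone_Qt_contactless(4)[of v] zvw by simp
  next
    case stick
    then show ?thesis using nT tangent_cone_Qt_stick(4)[of w] zvw by simp
  next
    case slip
    then show ?thesis using nT tangent_cone_Qt_slip(2)[OF vw] zvw by simp
  next
    case kink
    show ?thesis
    proof (cases "w $ 3 = 0")
      case True
      then have w0: "w = 0" using vw by (auto simp: mem_gph_Qt vec3_eq_iff split: if_splits)
      \<comment> \<open>At vanishing force the point is approached by lifting it off the contact
        surface.\<close>
      have pos: "0 < (v + t k *\<^sub>R axis 3 1) $ 3" for k using kink t by simp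
      show ?thesis
      proof (rule scd_S_const)
        have "(\<lambda>k. (v + t k *\<^sub>R axis 3 1, 0)) \<longlonglongrightarrow> (v + 0 *\<^sub>R axis 3 1, 0::real^3)"
          by (intro tendsto_intros t)
        then show "(\<lambda>k. (v + t k *\<^sub>R axis 3 1, 0)) \<longlonglongrightarrow> z" by (simp add: zvw w0)
        show "tangent_cone (gph (Qt \<F>)) (v + t k *\<^sub>R axis 3 1, 0) = range (\<lambda>h. (h, 0))" for k
          by (rule tangent_cone_Qt_contactless(2)[OF pos])
        show "(v + t k *\<^sub>R axis 3 1, 0) \<in> scd_O (Qt \<F>)" for k
          using tangent_cone_Qt_contactless[OF pos[of k]]
          by (simp add: scd_O_def Zspace_def)
      qed
    next
      case False
      then have w: "w $ 3 < 0" "fst2 v = 0" "norm (fst2 w) = - (\<F> * w $ 3)" using kink by auto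
      have v: "v = 0" using w kink by (simp add: vec3_eq_iff)
      \<comment> \<open>On the boundary of the friction cone the point is approached from its
        interior: only the tangential force shrinks, strictly because it is nonzero, while the
        radius is unchanged.\<close>
      define y where "y = (\<lambda>k. w - t k *\<^sub>R emb2 (fst2 w))"
      have "norm (fst2 (y k)) < - (\<F> * y k $ 3)" for k
      proof -
        have "norm (fst2 (y k)) = norm ((1 - t k) *\<^sub>R fst2 w)"
          by (simp add: y_def linear_fst2_simps algebra_simps)
        also have "\<dots> = (1 - t k) * norm (fst2 w)" using t(3)[of k] by simp
        also have "\<dots> < norm (fst2 w)"
          using t(2)[of k] w \<F> by (simp add: algebra_simps mult_pos_neg)
        finally show ?thesis using w by (simp add: y_def)
      qed
      moreover have "y k $ 3 < 0" for k using w by (simp add: y_def)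
      ultimately have y: "y k $ 3 < 0" "norm (fst2 (y k)) < - (\<F> * y k $ 3)" for k by auto
      show ?thesis
      proof (rule scd_S_const)
        have "(\<lambda>k. (0, y k)) \<longlonglongrightarrow> (0::real^3, w - 0 *\<^sub>R emb2 (fst2 w))"
          unfolding y_def by (intro tendsto_intros t)
        then show "(\<lambda>k. (0, y k)) \<longlonglongrightarrow> z" by (simp add: zvw v)
        show "tangent_cone (gph (Qt \<F>)) (0, y k) = range (\<lambda>h. (0, h))" for k
          by (rule tangent_cone_Qt_stick(2)[OF y])
        show "(0, y k) \<in> scd_O (Qt \<F>)" for k
          using tangent_cone_Qt_stick[OF y[of k]]
          by (simp add: scd_O_def Zspace_def)
      qed
    qed
  qed
qed

end


subsection \<open>The product mapping\<close>

context enumerated_blocks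
begin

context
  fixes \<F> :: real
  assumes \<F>: "0 < \<F>"
begin

lemma mem_scd_O_QQ:
  "z \<in> scd_O (QQ e p \<F>) \<longleftrightarrow> z \<in> C \<and> (\<forall>i<p. \<beta> i z \<in> scd_O (Qt \<F>))"
  and tangent_cone_QQ: "z \<in> scd_O (QQ e p \<F>) \<Longrightarrow>
    tangent_cone (gph (QQ e p \<F>)) z = PR (\<lambda>i. tangent_cone (gph (Qt \<F>)) (\<beta> i z))"
proof -
  let ?A = "\<lambda>i. gph (Qt \<F>)"
  let ?T = "\<lambda>i. tangent_cone (gph (Qt \<F>)) (\<beta> i z)"
  have prod: "tangent_cone (gph (QQ e p \<F>)) z = PR ?T" "z \<in> C \<and> (\<forall>i<p. \<beta> i z \<in> scd_O (Qt \<F>))"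
    if "z \<in> scd_O (QQ e p \<F>)"
  proof -
    have z: "z \<in> PR ?A" and T: "subspace (tangent_cone (PR ?A) z)"
      using that by (auto simp: scd_O_def Zspace_def gph_QQ)
    note sub = tangent_cone_PR_subspace[OF z T]
    show "tangent_cone (gph (QQ e p \<F>)) z = PR ?T" using sub(1) by (simp add: gph_QQ)
    show "z \<in> C \<and> (\<forall>i<p. \<beta> i z \<in> scd_O (Qt \<F>))"
      using z sub(2) tangent_cone_Qt_subspace[OF \<F>] by (auto simp: PR_def scd_O_def Zspace_def)
  qed
  have "z \<in> scd_O (QQ e p \<F>)" if z: "z \<in> C" "\<And>i. i < p \<Longrightarrow> \<beta> i z \<in> scd_O (Qt \<F>)"
  proof -
    have "tangent_cone (PR ?A) z = PR ?T"
      using z tangent_cone_Qt_subspace[OF \<F>]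
      by (intro tangent_cone_PR_derivable) (auto simp: scd_O_def Zspace_def)
    moreover have "PR ?T \<in> Zspace" using z(2) by (intro PR_Zspace) (auto simp: scd_O_def)
    ultimately show ?thesis using z by (auto simp: scd_O_def gph_QQ PR_def[of ?A])
  qed
  then show "z \<in> scd_O (QQ e p \<F>) \<longleftrightarrow> z \<in> C \<and> (\<forall>i<p. \<beta> i z \<in> scd_O (Qt \<F>))"
    using prod(2) by blast
  show "z \<in> scd_O (QQ e p \<F>) \<Longrightarrow> tangent_cone (gph (QQ e p \<F>)) z = PR ?T"
    by (rule prod(1))
qed

lemma scd_S_QQ:
  assumes "z \<in> gph (QQ e p \<F>)"
  shows "scd_S (QQ e p \<F>) z = {PR L | L. \<forall>i<p. L i \<in> scd_S (Qt \<F>) (\<beta> i z)}"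
proof (intro equalityI subsetI)
  fix M assume "M \<in> scd_S (QQ e p \<F>) z"
  then obtain zs where M: "M \<in> Zspace" and zs: "\<And>k. zs k \<in> scd_O (QQ e p \<F>)" "zs \<longlonglongrightarrow> z"
    and lim: "(\<lambda>k. dist_Z (tangent_cone (gph (QQ e p \<F>)) (zs k)) M) \<longlonglongrightarrow> 0"
    by (auto simp: scd_S_def)
  define T where "T = (\<lambda>k i. tangent_cone (gph (Qt \<F>)) (\<beta> i (zs k)))"
  have TQ: "tangent_cone (gph (QQ e p \<F>)) (zs k) = PR (T k)" for k
    unfolding T_def by (rule tangent_cone_QQ[OF zs(1)])
  have O: "\<beta> i (zs k) \<in> scd_O (Qt \<F>)" if "i < p" for i k
    using zs(1)[of k] that by (simp add: mem_scd_O_QQ)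
  have T: "T k i \<in> Zspace" if "i < p" for i k
    using O[OF that] by (simp add: T_def scd_O_def)
  then have Ts: "\<And>i k. i < p \<Longrightarrow> subspace (T k i)" by (simp add: Zspace_def)
  have Ms: "subspace M" using M by (simp add: Zspace_def)
  have TPs: "subspace (PR (T k))" for k by (rule subspace_PR[OF Ts])
  have lim': "(\<lambda>k. orth_proj (PR (T k)) x) \<longlonglongrightarrow> orth_proj M x" for x
    using dist_Z_tendsto_0_iff[of "\<lambda>k. PR (T k)" M, OF TPs Ms] lim unfolding TQ by blast
  have M_eq: "M = PR (\<lambda>i. \<beta> i ` M)"
    by (rule orth_proj_PR_limit(1)[OF Ts Ms lim'])
  have sub: "subspace (\<beta> i ` M)" if "i < p" for i
    by (rule orth_proj_PR_limit(2)[OF Ts Ms lim' that])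
  have lim\<beta>: "(\<lambda>k. orth_proj (T k i) y) \<longlonglongrightarrow> orth_proj (\<beta> i ` M) y" if "i < p" for i y
    by (rule orth_proj_PR_limit(3)[OF Ts Ms lim' that])
  have "\<beta> i ` M \<in> scd_S (Qt \<F>) (\<beta> i z)" if i: "i < p" for i
  proof -
    have d: "(\<lambda>k. dist_Z (T k i) (\<beta> i ` M)) \<longlonglongrightarrow> 0"
      using dist_Z_tendsto_0_iff[of "\<lambda>k. T k i" "\<beta> i ` M", OF Ts[OF i] sub[OF i]] lim\<beta>[OF i] by blast
    \<comment> \<open>The dimension of this block is inherited from the tangent spaces that converge
      to it; the dimension of \<open>M\<close> alone would not determine it.\<close>
    have "\<beta> i ` M \<in> Zspace" by (rule Zspace_limit[OF T[OF i] sub[OF i] d])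
    then show ?thesis
      using d O[OF i] \<beta>_tendsto[OF i zs(2)]
      by (auto simp: scd_S_def T_def intro!: exI[of _ "\<lambda>k. \<beta> i (zs k)"])
  qed
  then show "M \<in> {PR L | L. \<forall>i<p. L i \<in> scd_S (Qt \<F>) (\<beta> i z)}" using M_eq by blast
next
  fix M assume "M \<in> {PR L | L. \<forall>i<p. L i \<in> scd_S (Qt \<F>) (\<beta> i z)}"
  then obtain L where M: "M = PR L" and L: "\<And>i. i < p \<Longrightarrow> L i \<in> scd_S (Qt \<F>) (\<beta> i z)" by blast
  have LZ: "\<And>i. i < p \<Longrightarrow> L i \<in> Zspace" using L by (simp add: scd_S_def)
  then have Ls: "\<And>i. i < p \<Longrightarrow> subspace (L i)" by (simp add: Zspace_def)
  have z: "z \<in> C" using assms by (simp add: gph_QQ PR_def)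
  have "\<forall>i\<in>{..<p}. \<exists>zs. (\<forall>k::nat. zs k \<in> scd_O (Qt \<F>)) \<and> zs \<longlonglongrightarrow> \<beta> i z \<and>
      (\<lambda>k. dist_Z (tangent_cone (gph (Qt \<F>)) (zs k)) (L i)) \<longlonglongrightarrow> 0"
    using L by (auto simp: scd_S_def)
  from bchoice[OF this] obtain zs where zs: "\<And>i k. i < p \<Longrightarrow> zs i k \<in> scd_O (Qt \<F>)"
    "\<And>i. i < p \<Longrightarrow> zs i \<longlonglongrightarrow> \<beta> i z"
    "\<And>i. i < p \<Longrightarrow> (\<lambda>k. dist_Z (tangent_cone (gph (Qt \<F>)) (zs i k)) (L i)) \<longlonglongrightarrow> 0"
    by (auto simp: Ball_def)
  \<comment> \<open>The sequences chosen for the blocks are assembled into one, with the remaining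
    coordinates frozen at those of \<open>z\<close>.\<close>
  define y where "y = (\<lambda>k. z + sum_\<epsilon> (\<lambda>i. zs i k - \<beta> i z))"
  have \<beta>y: "\<beta> i (y k) = zs i k" if "i < p" for i k
    using that by (simp add: y_def \<beta>_add \<beta>_sum_\<epsilon>)
  have yO: "y k \<in> scd_O (QQ e p \<F>)" for k
    unfolding mem_scd_O_QQ using zs(1) by (auto simp: \<beta>y) (auto simp: y_def intro!: subspace_add C z sum_\<epsilon>_in_C)
  have "y \<longlonglongrightarrow> z + sum_\<epsilon> (\<lambda>i. \<beta> i z - \<beta> i z)"
    unfolding y_def by (intro tendsto_intros sum_\<epsilon>_tendsto zs(2))
  then have yz: "y \<longlonglongrightarrow> z" by (simp add: sum_\<epsilon>_0)
  define T where "T = (\<lambda>k i. tangent_cone (gph (Qt \<F>)) (\<beta> i (y k)))"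
  have TQ: "tangent_cone (gph (QQ e p \<F>)) (y k) = PR (T k)" for k
    unfolding T_def by (rule tangent_cone_QQ[OF yO])
  have Ts: "subspace (T k i)" if "i < p" for i k
    using zs(1)[OF that] by (simp add: T_def \<beta>y[OF that] scd_O_def Zspace_def)
  have "(\<lambda>k. orth_proj (T k i) x) \<longlonglongrightarrow> orth_proj (L i) x" if i: "i < p" for i x
  proof -
    have "(\<lambda>k. dist_Z (T k i) (L i)) \<longlonglongrightarrow> 0" using zs(3)[OF i] by (simp add: T_def \<beta>y[OF i])
    then show ?thesis
      using dist_Z_tendsto_0_iff[of "\<lambda>k. T k i" "L i", OF Ts[OF i] Ls[OF i]] by blast
  qed
  then have "(\<lambda>k. orth_proj (PR (T k)) x) \<longlonglongrightarrow> orth_proj (PR L) x" for x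
    by (intro orth_proj_PR_tendsto Ts Ls)
  moreover have "subspace (PR (T k))" "subspace (PR L)" for k
    by (rule subspace_PR, erule Ts Ls)+
  ultimately have "(\<lambda>k. dist_Z (PR (T k)) (PR L)) \<longlonglongrightarrow> 0"
    using dist_Z_tendsto_0_iff[of "\<lambda>k. PR (T k)" "PR L"] by blast
  then show "M \<in> scd_S (QQ e p \<F>) z"
    using PR_Zspace[OF LZ] yO yz by (auto simp: M scd_S_def TQ intro!: exI[of _ y])
qed

lemma scd_S_adj_QQ:
  assumes "z \<in> gph (QQ e p \<F>)"
  shows "scd_S_adj (QQ e p \<F>) z = {PR L | L. \<forall>i<p. L i \<in> scd_S_adj (Qt \<F>) (\<beta> i z)}"
proof (intro equalityI subsetI)
  fix M assume "M \<in> scd_S_adj (QQ e p \<F>) z"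
  then obtain L where L: "M = adj (PR L)" "\<And>i. i < p \<Longrightarrow> L i \<in> scd_S (Qt \<F>) (\<beta> i z)"
    unfolding scd_S_adj_eq scd_S_QQ[OF assms] by blast
  then have "M = PR (\<lambda>i. adj (L i))" by (auto simp: scd_S_def Zspace_def intro!: adj_PR)
  then show "M \<in> {PR L | L. \<forall>i<p. L i \<in> scd_S_adj (Qt \<F>) (\<beta> i z)}"
    using L(2) unfolding scd_S_adj_eq by blast
next
  fix M assume "M \<in> {PR L | L. \<forall>i<p. L i \<in> scd_S_adj (Qt \<F>) (\<beta> i z)}"
  then obtain L where L: "M = PR L" "\<forall>i\<in>{..<p}. \<exists>K. K \<in> scd_S (Qt \<F>) (\<beta> i z) \<and> L i = adj K"
    unfolding scd_S_adj_eq by blast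
  from bchoice[OF L(2)] obtain K where
    K: "\<And>i. i < p \<Longrightarrow> K i \<in> scd_S (Qt \<F>) (\<beta> i z)" "\<And>i. i < p \<Longrightarrow> L i = adj (K i)" by auto
  have "M = PR (\<lambda>i. adj (K i))" using L(1) K(2) by (auto simp: PR_def)
  also have "\<dots> = adj (PR K)"
    using K(1) by (intro adj_PR[symmetric]) (auto simp: scd_S_def Zspace_def)
  finally show "M \<in> scd_S_adj (QQ e p \<F>) z"
    unfolding scd_S_adj_eq scd_S_QQ[OF assms] using K(1) by blast
qed

end

text \<open>Membership in \<open>Zspace\<close> is what supplies the matrices. The families
  \<open>X i\<close> are left general so that the derivative and the adjoint derivative are covered
  at once.\<close>

lemma PR_family_eq_rge:
  assumes "\<And>i. i < p \<Longrightarrow> X i \<subseteq> Zspace"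
  shows "{PR L | L. \<forall>i<p. L i \<in> X i} =
    {rge (blockdiag e p A Id_entries) (blockdiag e p B Zero_entries) | A B. \<forall>i<p. rge (A i) (B i) \<in> X i}"
proof (intro equalityI subsetI)
  fix M assume "M \<in> {PR L | L. \<forall>i<p. L i \<in> X i}"
  then obtain L where L: "M = PR L" "\<And>i. i < p \<Longrightarrow> L i \<in> X i" by blast
  then have "L i \<in> Zspace" if "i < p" for i using assms that by blast
  from Zspace_family_rge[of p L, OF this]
  obtain A B where AB: "\<And>i. i < p \<Longrightarrow> L i = rge (A i) (B i)" by auto
  have "M = PR (\<lambda>i. rge (A i) (B i))" using L(1) AB by (auto simp: PR_def)
  then have "M = rge (blockdiag e p A Id_entries) (blockdiag e p B Zero_entries)"
    by (simp add: rge_blockdiag)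
  then show "M \<in> {rge (blockdiag e p A Id_entries) (blockdiag e p B Zero_entries) | A B.
      \<forall>i<p. rge (A i) (B i) \<in> X i}" using L(2) AB by auto
qed (auto simp: rge_blockdiag)

end

theorem corollary6p8:
  fixes e :: "nat \<Rightarrow> 'n::finite" and p :: nat and \<F> :: real
  assumes "bij_betw e {..<CARD('n)} UNIV"
    and "1 \<le> p" and "3 * p \<le> CARD('n)" and "0 < \<F>"
  shows "SCD (QQ e p \<F>) \<and>
    scd_O (QQ e p \<F>) = {(u, w). (\<forall>i<p. (block e i u, block e i w) \<in> scd_O (Qt \<F>))
                           \<and> rest e p w = (\<lambda>k. 0)} \<and>
    (\<forall>u w. (u, w) \<in> gph (QQ e p \<F>) \<longrightarrow>
      scd_S (QQ e p \<F>) (u, w) =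
        {rge (blockdiag e p U Id_entries) (blockdiag e p W Zero_entries) | U W.
           \<forall>i<p. rge (U i) (W i) \<in> scd_S (Qt \<F>) (block e i u, block e i w)} \<and>
      scd_S_adj (QQ e p \<F>) (u, w) =
        {rge (blockdiag e p W' Id_entries) (blockdiag e p U' Zero_entries) | W' U'.
           \<forall>i<p. rge (W' i) (U' i) \<in> scd_S_adj (Qt \<F>) (block e i u, block e i w)})"
proof -
  interpret enumerated_blocks e p using assms(1,3) by unfold_locales
  note \<F> = \<open>0 < \<F>\<close>
  have "scd_S_adj (QQ e p \<F>) z \<noteq> {}" if z: "z \<in> gph (QQ e p \<F>)" for z
  proof -
    have "\<beta> i z \<in> gph (Qt \<F>)" if "i < p" for i using z that by (simp add: gph_QQ PR_def)
    then have "\<forall>i\<in>{..<p}. \<exists>L. L \<in> scd_S_adj (Qt \<F>) (\<beta> i z)"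
      using scd_S_Qt_nonempty[OF \<F>] unfolding scd_S_adj_eq by blast
    from bchoice[OF this] obtain L where "\<forall>i<p. L i \<in> scd_S_adj (Qt \<F>) (\<beta> i z)" by auto
    then show ?thesis unfolding scd_S_adj_QQ[OF \<F> z] by blast
  qed
  then have scd: "SCD (QQ e p \<F>)" by (simp add: SCD_def)
  have O: "scd_O (QQ e p \<F>) = {(u, w). (\<forall>i<p. (block e i u, block e i w) \<in> scd_O (Qt \<F>))
      \<and> rest e p w = (\<lambda>k. 0)}"
    by (auto simp: mem_scd_O_QQ[OF \<F>] C_def \<beta>_def)
  have S: "scd_S (QQ e p \<F>) (u, w) =
      {rge (blockdiag e p U Id_entries) (blockdiag e p W Zero_entries) | U W.
         \<forall>i<p. rge (U i) (W i) \<in> scd_S (Qt \<F>) (block e i u, block e i w)}"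
    if "(u, w) \<in> gph (QQ e p \<F>)" for u w
  proof -
    have sub: "scd_S (Qt \<F>) (\<beta> i (u, w)) \<subseteq> Zspace" for i by (auto simp: scd_S_def)
    show ?thesis
      using trans[OF scd_S_QQ[OF \<F> that] PR_family_eq_rge[OF sub]] by (simp only: \<beta>_def fst_conv snd_conv)
  qed
  have S_adj: "scd_S_adj (QQ e p \<F>) (u, w) =
      {rge (blockdiag e p W' Id_entries) (blockdiag e p U' Zero_entries) | W' U'.
         \<forall>i<p. rge (W' i) (U' i) \<in> scd_S_adj (Qt \<F>) (block e i u, block e i w)}"
    if "(u, w) \<in> gph (QQ e p \<F>)" for u w
  proof -
    have sub: "scd_S_adj (Qt \<F>) (\<beta> i (u, w)) \<subseteq> Zspace" for i by (auto simp: scd_S_adj_def)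
    show ?thesis
      using trans[OF scd_S_adj_QQ[OF \<F> that] PR_family_eq_rge[OF sub]] by (simp only: \<beta>_def fst_conv snd_conv)
  qed
  show ?thesis
    by (intro conjI allI impI scd O S S_adj)
qed

end
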